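(* Let $n\ge 2$. There exists a constant $c_n$ depending only on $n$ such that for every weight $w\in A_1$ on $\mathbb{R}^n$, every Lipschitz function $f$ on $\mathbb{R}^n$ with compact support, and every $x\in\mathbb{R}^n$, $$|f(x)|\le c_n\,[w]_{A_1}\,T_w(|\nabla f|)(x).$$
   Context: A weight is a non-negative locally integrable function $w$ on $\mathbb{R}^n$, not identically zero; for a ball $B$ write $w(B)=\int_B w(x)\,dx$. The weight $w$ is in the class $A_1$ if there is a constant $C$ such that for every ball $B$, $\frac{1}{|B|}\int_B w(z)\,dz\le C\,w(x)$ for almost every $x\in B$; the least such $C$ is denoted $[w]_{A_1}$. $B(x,r)$ is the Euclidean ball with center $x$ and radius $r$. The potential type operator $T_w$ is $$T_wf(x)=\int_{\mathbb{R}^n}\frac{|x-y|}{w(B(x,|x-y|))}\,f(y)\,w(y)\,dy.$$ For non-negative $f$ the value may be $+\infty$. *)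

theory Defs
  imports "HOL-Analysis.Analysis"
begin

(* A weight represents an element of L^1_loc, so "not identically zero" is read as
   "not almost everywhere zero"; otherwise w(B) could vanish for every ball B. *)
definition is_weight :: "('a::euclidean_space \<Rightarrow> real) \<Rightarrow> bool" where
  "is_weight w \<longleftrightarrow>
     (\<forall>x. 0 \<le> w x) \<and>
     (\<forall>K. compact K \<longrightarrow> w absolutely_integrable_on K) \<and>
     \<not> (AE x in lebesgue. w x = 0)"

definition weight_of :: "('a::euclidean_space \<Rightarrow> real) \<Rightarrow> 'a set \<Rightarrow> real" where
  "weight_of w B = (LINT x:B|lebesgue. w x)"

definition A1_bound :: "('a::euclidean_space \<Rightarrow> real) \<Rightarrow> real \<Rightarrow> bool" where
  "A1_bound w C \<longleftrightarrow>
     (\<forall>a r. 0 < r \<longrightarrow>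
        (AE x in lebesgue. x \<in> ball a r \<longrightarrow>
           weight_of w (ball a r) / measure lebesgue (ball a r) \<le> C * w x))"

definition in_A1 :: "('a::euclidean_space \<Rightarrow> real) \<Rightarrow> bool" where
  "in_A1 w \<longleftrightarrow> is_weight w \<and> (\<exists>C. A1_bound w C)"

(* The infimum is attained, see A1_const_least below. *)
definition A1_const :: "('a::euclidean_space \<Rightarrow> real) \<Rightarrow> real" where
  "A1_const w = Inf {C. A1_bound w C}"

(* Gradient of a real-valued function, set to 0 where f is not (Frechet) differentiable;
   for Lipschitz f this exceptional set is null by Rademacher's theorem. *)
definition gradient :: "('a::euclidean_space \<Rightarrow> real) \<Rightarrow> 'a \<Rightarrow> 'a" where
  "gradient f x = (if f differentiable (at x) then THE D. GDERIV f x :> D else 0)"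

(* T_w on non-negative functions, with values in [0, \<infinity>]. The value of the kernel at y = x
   (a real division 0 / 0 = 0) is irrelevant, {x} being a null set. *)
definition potential_op ::
    "('a::euclidean_space \<Rightarrow> real) \<Rightarrow> ('a \<Rightarrow> ennreal) \<Rightarrow> 'a \<Rightarrow> ennreal" where
  "potential_op w f x =
     (\<integral>\<^sup>+ y. ennreal (norm (x - y) / weight_of w (ball x (norm (x - y)))) * f y * ennreal (w y)
       \<partial>lebesgue)"

lemma weight_of_nonneg: "is_weight w \<Longrightarrow> 0 \<le> weight_of w B"
  unfolding weight_of_def set_lebesgue_integral_def is_weight_def
  by (intro Bochner_Integration.integral_nonneg) (auto simp: indicator_def)

lemma A1_bound_nonneg:
  fixes w :: "'a::euclidean_space \<Rightarrow> real"
  assumes "is_weight w" "A1_bound w C"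
  shows "0 \<le> C"
proof (rule ccontr)
  assume C: "\<not> 0 \<le> C"
  have w0: "0 \<le> w x" for x using assms(1) by (simp add: is_weight_def)
  have "AE x in lebesgue. x \<in> ball 0 (real (Suc k)) \<longrightarrow> w x = 0" for k
  proof -
    have "AE x in lebesgue. x \<in> ball 0 (real (Suc k)) \<longrightarrow>
       weight_of w (ball 0 (real (Suc k))) / measure lebesgue (ball 0 (real (Suc k)) :: 'a set)
         \<le> C * w x"
      using assms(2) unfolding A1_bound_def by (metis of_nat_0_less_iff zero_less_Suc)
    then show ?thesis
    proof (rule AE_mp, intro AE_I2 impI)
      fix x :: 'a
      assume "x \<in> ball 0 (real (Suc k)) \<longrightarrow>
        weight_of w (ball 0 (real (Suc k))) / measure lebesgue (ball 0 (real (Suc k)) :: 'a set)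
          \<le> C * w x" and "x \<in> ball 0 (real (Suc k))"
      then have "0 \<le> C * w x"
        using weight_of_nonneg[OF assms(1)]
        by (meson divide_nonneg_nonneg measure_nonneg order_trans)
      then show "w x = 0" using C w0[of x] by (simp add: zero_le_mult_iff)
    qed
  qed
  then have "AE x in lebesgue. \<forall>k. x \<in> ball 0 (real (Suc k)) \<longrightarrow> w x = 0"
    by (subst AE_all_countable) blast
  then have "AE x in lebesgue. w x = 0"
  proof (rule AE_mp, intro AE_I2 impI)
    fix x :: 'a
    assume *: "\<forall>k. x \<in> ball 0 (real (Suc k)) \<longrightarrow> w x = 0"
    obtain k where "norm x < real k" using reals_Archimedean2 by blast
    then have "x \<in> ball 0 (real (Suc k))" by simp
    then show "w x = 0" using * by blast
  qed
  then show False using assms(1) by (simp add: is_weight_def)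
qed

lemma A1_const_least:
  fixes w :: "'a::euclidean_space \<Rightarrow> real"
  assumes "in_A1 w"
  shows "A1_bound w (A1_const w)" and "A1_bound w C \<Longrightarrow> A1_const w \<le> C"
proof -
  have bdd: "bdd_below {C. A1_bound w C}"
    using A1_bound_nonneg assms by (auto simp: in_A1_def intro!: bdd_belowI[of _ 0])
  have ne: "{C. A1_bound w C} \<noteq> {}" using assms by (auto simp: in_A1_def)
  show "A1_bound w C \<Longrightarrow> A1_const w \<le> C"
    unfolding A1_const_def by (rule cInf_lower) (auto simp: bdd)
  have w0: "0 \<le> w x" for x using assms by (simp add: in_A1_def is_weight_def)
  show "A1_bound w (A1_const w)"
    unfolding A1_bound_def
  proof (intro allI impI)
    fix a :: 'a and r :: real
    assume r: "0 < r"
    let ?avg = "weight_of w (ball a r) / measure lebesgue (ball a r)"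
    have "AE x in lebesgue. x \<in> ball a r \<longrightarrow> ?avg \<le> (A1_const w + inverse (real (Suc k))) * w x"
      for k
    proof -
      have "Inf {C. A1_bound w C} < A1_const w + inverse (real (Suc k))"
        by (simp add: A1_const_def)
      then obtain C where C: "A1_bound w C" "C < A1_const w + inverse (real (Suc k))"
        using cInf_lessD[OF ne] by blast
      have "AE x in lebesgue. x \<in> ball a r \<longrightarrow> ?avg \<le> C * w x"
        using C(1) r by (simp add: A1_bound_def)
      then show ?thesis
      proof (rule AE_mp, intro AE_I2 impI)
        fix x :: 'a
        assume "x \<in> ball a r \<longrightarrow> ?avg \<le> C * w x" "x \<in> ball a r"
        then have "?avg \<le> C * w x" by blast
        also have "\<dots> \<le> (A1_const w + inverse (real (Suc k))) * w x"
          using C(2) w0[of x] by (intro mult_right_mono) auto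
        finally show "?avg \<le> (A1_const w + inverse (real (Suc k))) * w x" .
      qed
    qed
    then have "AE x in lebesgue. \<forall>k. x \<in> ball a r \<longrightarrow>
        ?avg \<le> (A1_const w + inverse (real (Suc k))) * w x"
      by (subst AE_all_countable) blast
    then show "AE x in lebesgue. x \<in> ball a r \<longrightarrow> ?avg \<le> A1_const w * w x"
    proof (rule AE_mp, intro AE_I2 impI)
      fix x :: 'a
      assume *: "\<forall>k. x \<in> ball a r \<longrightarrow> ?avg \<le> (A1_const w + inverse (real (Suc k))) * w x"
        and "x \<in> ball a r"
      then have le: "?avg \<le> (A1_const w + inverse (real (Suc k))) * w x" for k by blast
      have "(\<lambda>k. (A1_const w + inverse (real (Suc k))) * w x) \<longlonglongrightarrow> (A1_const w + 0) * w x"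
        by (intro tendsto_intros LIMSEQ_inverse_real_of_nat)
      from LIMSEQ_le_const[OF this] le show "?avg \<le> A1_const w * w x" by auto
    qed
  qed
qed

lemma gradient_eq:
  assumes "GDERIV f x :> D"
  shows "gradient f x = D"
proof -
  have "D' = D" if "GDERIV f x :> D'" for D'
  proof -
    have "(\<lambda>h. inner h D') = (\<lambda>h. inner h D)"
      using has_derivative_unique that assms unfolding gderiv_def by blast
    then show ?thesis by (metis inner_commute vector_eq_rdot)
  qed
  then have "(THE D. GDERIV f x :> D) = D" using assms by blast
  moreover have "f differentiable (at x)"
    using assms unfolding gderiv_def differentiable_def by blast
  ultimately show ?thesis by (simp add: gradient_def)
qed

end

theory Submission
  imports Defs
begin

text \<open>
  By the \<open>A\<^sub>1\<close> condition, \<open>w(B(x, r)) \<le> C \<bar>B(x, 2 r)\<bar> w(y)\<close> for almost every \<open>y\<close>, where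
  \<open>r = \<bar>x - y\<bar>\<close>. The kernel of \<open>T\<^sub>w\<close>, multiplied by \<open>w(y)\<close>, is therefore at least a constant
  multiple of \<open>r\<^sup>1\<^sup>-\<^sup>n / C\<close> (\<open>A1_kernel_lower_bound\<close>). This reduces the theorem to its
  unweighted form, the pointwise bound of \<open>\<bar>f(x)\<bar>\<close> by the Riesz potential
  \<open>\<integral> \<bar>\<nabla>f(y)\<bar> \<bar>x - y\<bar>\<^sup>1\<^sup>-\<^sup>n dy\<close> (\<open>lipschitz_le_riesz_potential\<close>).

  For the unweighted bound, the fundamental theorem of calculus along the ray
  \<open>t \<mapsto> x + t u\<close> gives \<open>\<bar>f(x)\<bar> \<le> \<integral>\<^sub>0\<^sup>\<infinity> \<bar>\<nabla>f(x + t u)\<bar> \<bar>u\<bar> dt\<close>, since \<open>f\<close> vanishes far out. Averaging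
  over \<open>u\<close> in the annulus \<open>1 \<le> \<bar>u\<bar> \<le> 2\<close> and substituting \<open>y = x + t u\<close> for fixed \<open>t\<close> produces the
  Riesz kernel.

  As the gradient is set to \<open>0\<close> at points of non-differentiability, the bound rests on
  Rademacher's theorem, that a Lipschitz function is differentiable almost everywhere. On the line,
  a Lipschitz function plus a steep linear function induces an absolutely continuous measure, and
  the Radon--Nikodym density of that measure is the derivative almost everywhere by Lebesgue's
  differentiation theorem (\<open>lipschitz_real_derivative\<close>). Fubini's theorem along parallel lines
  then gives a derivative in each fixed direction almost everywhere (\<open>AE_has_dir_deriv\<close>).
  Integrating difference quotients over boxes shows that this derivative is additive in the direction
  (\<open>dir_deriv_add\<close>), and a countable dense set of directions suffices to make \<open>f\<close> differentiable
  (\<open>gderiv_of_dense_dir_derivs\<close>).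
\<close>

section \<open>Lipschitz functions of one real variable\<close>

text \<open>
  Lebesgue's differentiation theorem on cubes with one corner at \<open>x\<close> is, on the line, a statement
  about the intervals \<open>[x, x + h]\<close>, hence about right derivatives.
\<close>

lemma AE_has_right_derivative_of_integral:
  fixes G \<phi> :: "real \<Rightarrow> real"
  assumes G: "\<And>a b. a \<le> b \<Longrightarrow> (\<phi> has_integral (G b - G a)) {a..b}"
  shows "AE x in lborel. (G has_real_derivative \<phi> x) (at_right x)"
proof -
  have "\<phi> integrable_on cbox a b" for a b
    using G[of a b] by (cases "a \<le> b") (auto simp: integrable_on_def)
  then obtain N where N: "negligible N"
    and lim: "\<And>x e. \<lbrakk>x \<notin> N; 0 < e\<rbrakk> \<Longrightarrow> \<exists>d>0. \<forall>h. 0 < h \<and> h < d \<longrightarrow>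
        norm (integral (cbox x (x + h *\<^sub>R One)) \<phi> /\<^sub>R h ^ DIM(real) - \<phi> x) < e"
    using integrable_ccontinuous_explicit[of \<phi>] by metis
  have "(G has_real_derivative \<phi> x) (at_right x)" if "x \<notin> N" for x
    unfolding has_field_derivative_iff tendsto_iff
  proof (intro allI impI)
    fix e :: real assume "0 < e"
    with lim[OF that] obtain d where d: "d > 0"
      and dlim: "\<And>h. 0 < h \<and> h < d \<Longrightarrow> \<bar>integral {x..x + h} \<phi> / h - \<phi> x\<bar> < e"
      by (fastforce simp: divide_inverse mult.commute)
    have "dist ((G y - G x) / (y - x)) (\<phi> x) < e" if "x < y" "y < x + d" for y
      using dlim[of "y - x"] that G[of x y] by (simp add: integral_unique dist_real_def)
    then show "\<forall>\<^sub>F y in at_right x. dist ((G y - G x) / (y - x)) (\<phi> x) < e"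
      unfolding eventually_at_right_field using d by (intro exI[of _ "x + d"]) auto
  qed
  then have "AE x in lebesgue. (G has_real_derivative \<phi> x) (at_right x)"
    using N by (intro AE_I'[of N]) (auto simp: negligible_iff_null_sets)
  then show ?thesis by (simp add: AE_completion_iff)
qed

lemma AE_lborel_uminus:
  fixes P :: "'a::euclidean_space \<Rightarrow> bool"
  assumes "AE x in lborel. P x"
  shows "AE x in lborel. P (- x)"
proof -
  obtain N where N: "N \<in> null_sets lborel" "{x. \<not> P x} \<subseteq> N"
    using assms by (auto simp: eventually_ae_filter)
  have "negligible N" using N(1) by (simp add: negligible_iff_null_sets null_sets_completionI)
  then have "negligible (uminus ` N)"
    by (intro negligible_locally_Lipschitz_image)
       (auto intro!: exI[of _ UNIV] exI[of _ 1] simp: norm_minus_commute)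
  moreover have "{x. \<not> P (- x)} \<subseteq> uminus ` N"
    using N(2) by (force intro: rev_image_eqI)
  ultimately have "AE x in lebesgue. P (- x)"
    by (intro AE_I'[of "uminus ` N"]) (auto simp: negligible_iff_null_sets)
  then show ?thesis by (simp add: AE_completion_iff)
qed

lemma has_integral_mult_indicator_iff:
  fixes \<phi> :: "'a::euclidean_space \<Rightarrow> real"
  shows "((\<lambda>x. \<phi> x * indicator S x) has_integral I) UNIV \<longleftrightarrow> (\<phi> has_integral I) S"
  unfolding has_integral_restrict_UNIV[symmetric, of \<phi>]
  by (rule has_integral_cong) (auto simp: indicator_def)

text \<open>
  The left derivative of \<open>G\<close> at \<open>x\<close> is the right derivative of \<open>t \<mapsto> - G (- t)\<close> at \<open>- x\<close>, so
  reflecting the line turns the one-sided result into the two-sided one.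
\<close>

lemma AE_has_derivative_of_integral:
  fixes G \<phi> :: "real \<Rightarrow> real"
  assumes G: "\<And>a b. a \<le> b \<Longrightarrow> (\<phi> has_integral (G b - G a)) {a..b}"
  shows "AE x in lborel. (G has_real_derivative \<phi> x) (at x)"
proof -
  have "((\<lambda>t. \<phi> (- t)) has_integral (- G (- b) - - G (- a))) {a..b}" if "a \<le> b" for a b
    using G[of "- b" "- a"] that has_integral_reflect_real[of \<phi> _ "- a" "- b"] by (simp del: has_integral_reflect_real)
  from AE_has_right_derivative_of_integral[of "\<lambda>t. \<phi> (- t)" "\<lambda>t. - G (- t)", OF this]
  have "AE x in lborel. ((\<lambda>t. - G (- t)) has_real_derivative \<phi> (- x)) (at_right x)" .
  from AE_lborel_uminus[OF this]
  have left: "AE x in lborel. ((\<lambda>t. - G (- t)) has_real_derivative \<phi> x) (at_right (- x))"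
    by simp
  have right: "AE x in lborel. (G has_real_derivative \<phi> x) (at_right x)"
    by (rule AE_has_right_derivative_of_integral) (rule G)
  show ?thesis
    using left right
  proof eventually_elim
    case (elim x)
    have "((\<lambda>y. (- G (- y) - - G (- (- x))) / (y - - x)) \<longlongrightarrow> \<phi> x) (at_right (- x))"
      using elim(1) unfolding has_field_derivative_iff .
    then have "((\<lambda>y. (- G (- (- y)) - - G (- (- x))) / (- y - - x)) \<longlongrightarrow> \<phi> x) (at_left x)"
      by (subst filterlim_at_left_to_right) simp
    moreover have "(- G (- (- y)) - - G (- (- x))) / (- y - - x) = (G y - G x) / (y - x)" for y
      using minus_divide_divide[of "G y - G x" "y - x"] by (simp add: algebra_simps)
    ultimately have "((\<lambda>y. (G y - G x) / (y - x)) \<longlongrightarrow> \<phi> x) (at_left x)"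
      by simp
    with elim(2) show ?case
      unfolding has_field_derivative_iff filterlim_at_split by simp
  qed
qed

text \<open>
  The pull-back of Lebesgue measure along the homeomorphism \<open>F\<close> gives \<open>[a, b]\<close> the mass
  \<open>F b - F a\<close>. It is absolutely continuous because \<open>F\<close>, being Lipschitz, maps null sets to null
  sets, and its Radon--Nikodym density is the function sought. The lower bound on the increments
  makes \<open>F\<close> a bijection of the line, which allows defining the pull-back as an image measure
  under the inverse \<open>H\<close>.
\<close>

lemma bilipschitz_increments_have_density:
  fixes F :: "real \<Rightarrow> real"
  assumes lo: "\<And>x y. x \<le> y \<Longrightarrow> y - x \<le> F y - F x"
    and hi: "\<And>x y. x \<le> y \<Longrightarrow> F y - F x \<le> M * (y - x)"
  obtains \<psi> where "\<psi> \<in> borel_measurable borel" "\<And>a b. a \<le> b \<Longrightarrow> (\<psi> has_integral (F b - F a)) {a..b}"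
proof -
  have lip: "\<bar>F y - F x\<bar> \<le> M * \<bar>y - x\<bar>" for x y
    using lo[of x y] hi[of x y] lo[of y x] hi[of y x] by (cases "x \<le> y") (auto simp: abs_if)
  have M0: "0 \<le> M" using lip[of 1 0] by simp
  have smono: "F x < F y \<longleftrightarrow> x < y" for x y
    using lo[of x y] lo[of y x] by linarith
  have contF: "continuous_on UNIV F"
    by (rule lipschitz_on_continuous_on[of M])
       (auto simp: lipschitz_on_def dist_real_def M0 intro: lip)
  have mono_iff: "F x \<le> F y \<longleftrightarrow> x \<le> y" for x y
    using smono[of y x] by linarith
  have injF: "inj F" using smono by (metis injI linorder_neq_iff)
  have surjF: "\<exists>x. F x = y" for y
  proof -
    define r where "r = \<bar>y - F 0\<bar>"
    have "F (- r) \<le> y" "y \<le> F r" using lo[of 0 r] lo[of "- r" 0] by (auto simp: r_def)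
    moreover have "- r \<le> r" by (simp add: r_def)
    ultimately show ?thesis
      using IVT'[of F "- r" y r] continuous_on_subset[OF contF] by blast
  qed
  define H where "H = inv F"
  have FH: "F (H y) = y" for y unfolding H_def using surjF by (metis f_inv_into_f rangeI)
  have HF: "H (F x) = x" for x unfolding H_def using injF by simp
  have "mono H"
    by (rule monoI) (metis FH smono linorder_not_le)
  then have [measurable]: "H \<in> borel_measurable borel"
    by (rule borel_measurable_mono)
  define \<mu> where "\<mu> = distr lborel borel H"
  have \<mu>_eq: "emeasure \<mu> A = emeasure lborel (F ` A)" if [measurable]: "A \<in> sets borel" for A
  proof -
    have "H -` A = F ` A" using FH HF by (auto simp: image_iff) metis
    then show ?thesis by (simp add: \<mu>_def emeasure_distr)
  qed
  have "absolutely_continuous lborel \<mu>"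
    unfolding absolutely_continuous_def
  proof
    fix A :: "real set" assume A: "A \<in> null_sets lborel"
    then have "negligible A" by (simp add: negligible_iff_null_sets null_sets_completionI)
    then have "negligible (F ` A)"
      using lip by (intro negligible_locally_Lipschitz_image) (auto intro!: exI[of _ UNIV] exI[of _ M])
    moreover have meas: "A \<in> sets borel" using A by auto
    moreover have "F ` A \<in> sets borel"
    proof -
      have "F ` A = H -` A" using FH HF by (auto simp: image_iff) metis
      then show ?thesis using measurable_sets[OF \<open>H \<in> borel_measurable borel\<close> meas] by simp
    qed
    ultimately have "emeasure lborel (F ` A) = 0"
      by (auto simp: negligible_iff_null_sets null_sets_def)
    with meas show "A \<in> null_sets \<mu>"
      by (intro null_setsI) (simp_all only: \<mu>_eq, simp add: \<mu>_def)
  qed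
  moreover have "sets \<mu> = sets lborel" by (simp add: \<mu>_def)
  ultimately obtain \<phi> where [measurable]: "\<phi> \<in> borel_measurable lborel" and \<phi>: "density lborel \<phi> = \<mu>"
    using sigma_finite_measure.Radon_Nikodym[OF sigma_finite_lborel] by blast
  have int: "(\<integral>\<^sup>+x. \<phi> x * indicator {a..b} x \<partial>lborel) = ennreal (F b - F a)" if "a \<le> b" for a b
  proof -
    have "(\<integral>\<^sup>+x. \<phi> x * indicator {a..b} x \<partial>lborel) = emeasure \<mu> {a..b}"
      unfolding \<phi>[symmetric] by (simp add: emeasure_density)
    also have "\<dots> = emeasure lborel (F ` {a..b})" by (simp add: \<mu>_eq)
    also have "F ` {a..b} = {F a..F b}"
    proof (intro set_eqI iffI)
      fix y assume "y \<in> {F a..F b}"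
      then have "y = F (H y)" "H y \<in> {a..b}"
        using mono_iff[of a "H y"] mono_iff[of "H y" b] by (auto simp: FH)
      then show "y \<in> F ` {a..b}" by blast
    qed (auto simp: mono_iff)
    also have "emeasure lborel \<dots> = ennreal (F b - F a)"
      using lo[OF that] that by (simp)
    finally show ?thesis .
  qed
  have fin: "AE x in lborel. \<phi> x \<noteq> \<infinity>"
  proof -
    have "AE x in lborel. \<phi> x * indicator {- real k..real k} x \<noteq> \<infinity>" for k :: nat
      by (rule nn_integral_noteq_infinite) (auto simp: int)
    then have "AE x in lborel. \<forall>k::nat. \<phi> x * indicator {- real k..real k} x \<noteq> \<infinity>"
      by (simp add: AE_all_countable)
    then show ?thesis
    proof eventually_elim
      case (elim x)
      obtain k :: nat where "\<bar>x\<bar> \<le> real k" using real_arch_simple by blast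
      then have "x \<in> {- real k..real k}" by auto
      with elim[rule_format, of k] show ?case by simp
    qed
  qed
  define \<psi> where "\<psi> x = enn2real (\<phi> x)" for x
  have [measurable]: "\<psi> \<in> borel_measurable borel" unfolding \<psi>_def by measurable
  have \<psi>_int: "(\<psi> has_integral (F b - F a)) {a..b}" if "a \<le> b" for a b
  proof -
    have "(\<integral>\<^sup>+x. ennreal (\<psi> x * indicator {a..b} x) \<partial>lborel) = (\<integral>\<^sup>+x. \<phi> x * indicator {a..b} x \<partial>lborel)"
      by (rule nn_integral_cong_AE, use fin in eventually_elim)
         (simp add: \<psi>_def ennreal_enn2real_if split: split_indicator)
    then have "((\<lambda>x. \<psi> x * indicator {a..b} x) has_integral (F b - F a)) UNIV"
      using int[OF that] lo[OF that] that
      by (intro nn_integral_has_integral) (auto simp: \<psi>_def)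
    then show ?thesis
      by (simp add: has_integral_mult_indicator_iff)
  qed
  show thesis by (rule that[OF \<open>\<psi> \<in> borel_measurable borel\<close> \<psi>_int])
qed

text \<open>
  A Lipschitz function need not be monotone, but adding a steep linear function makes its
  increments comparable to those of the identity.
\<close>

lemma lipschitz_real_derivative:
  fixes g :: "real \<Rightarrow> real"
  assumes "L-lipschitz_on UNIV g"
  obtains \<phi> where "\<phi> \<in> borel_measurable borel" "AE t in lborel. (g has_real_derivative \<phi> t) (at t)"
    "\<And>a b. a \<le> b \<Longrightarrow> (\<phi> has_integral (g b - g a)) {a..b}"
proof -
  have lip: "\<bar>g y - g x\<bar> \<le> L * \<bar>y - x\<bar>" for x y
    using lipschitz_onD[OF assms, of y x] by (simp add: dist_real_def)
  define F where "F x = g x + (L + 1) * x" for x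
  have F: "y - x \<le> F y - F x" "F y - F x \<le> (2 * L + 1) * (y - x)" if "x \<le> y" for x y
    using lip[of y x] that by (auto simp: F_def algebra_simps abs_le_iff)
  obtain \<psi> where [measurable]: "\<psi> \<in> borel_measurable borel"
    and \<psi>: "\<And>a b. a \<le> b \<Longrightarrow> (\<psi> has_integral (F b - F a)) {a..b}"
    using bilipschitz_increments_have_density[OF F] by blast
  define \<phi> where "\<phi> t = \<psi> t - (L + 1)" for t
  have int: "(\<phi> has_integral (g b - g a)) {a..b}" if "a \<le> b" for a b
    using has_integral_diff[OF \<psi>[OF that] has_integral_const_real[of "L + 1" a b]] that
    by (simp add: \<phi>_def[abs_def] F_def algebra_simps)
  show thesis
    by (rule that[OF _ AE_has_derivative_of_integral[OF int] int]) (auto simp: \<phi>_def[abs_def])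
qed

text \<open>
  The fundamental theorem of calculus as an inequality in \<open>[0, \<infinity>]\<close>. Along a ray the integral of
  the majorant \<open>h\<close> may well be infinite, and then there is nothing to prove.
\<close>

lemma lipschitz_increment_le_nn_integral:
  fixes g :: "real \<Rightarrow> real"
  assumes "L-lipschitz_on UNIV g" "a \<le> b"
    and bd: "AE t in lborel. \<forall>D. (g has_real_derivative D) (at t) \<longrightarrow> ennreal \<bar>D\<bar> \<le> h t"
  shows "ennreal \<bar>g b - g a\<bar> \<le> (\<integral>\<^sup>+t. h t * indicator {a..b} t \<partial>lborel)"
proof -
  obtain \<phi> where [measurable]: "\<phi> \<in> borel_measurable borel"
    and der: "AE t in lborel. (g has_real_derivative \<phi> t) (at t)"
    and int: "(\<phi> has_integral (g b - g a)) {a..b}"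
    using lipschitz_real_derivative[OF assms(1)] assms(2) by metis
  have "AE t in lborel. ennreal \<bar>\<phi> t\<bar> \<le> h t"
    using der bd by eventually_elim auto
  then have le: "(\<integral>\<^sup>+t. ennreal \<bar>\<phi> t\<bar> * indicator {a..b} t \<partial>lborel) \<le> (\<integral>\<^sup>+t. h t * indicator {a..b} t \<partial>lborel)"
    by (intro nn_integral_mono_AE) (auto elim!: eventually_mono split: split_indicator)
  show ?thesis
  proof (cases "(\<integral>\<^sup>+t. ennreal \<bar>\<phi> t\<bar> * indicator {a..b} t \<partial>lborel) = \<infinity>")
    case False
    have eq: "ennreal \<bar>\<phi> t\<bar> * indicator {a..b} t = ennreal (norm (\<phi> t * indicator {a..b} t))" for t
      by (auto split: split_indicator)
    have I: "integrable lborel (\<lambda>t. \<phi> t * indicator {a..b} t)"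
      using False by (intro integrableI_bounded) (simp_all add: eq top.not_eq_extremum)
    have "((\<lambda>t. \<phi> t * indicator {a..b} t) has_integral (LINT t|lborel. \<phi> t * indicator {a..b} t)) UNIV"
      using I by (rule has_integral_integral_lborel)
    then have "(\<phi> has_integral (LINT t|lborel. \<phi> t * indicator {a..b} t)) {a..b}"
      by (simp add: has_integral_mult_indicator_iff)
    then have "g b - g a = (LINT t|lborel. \<phi> t * indicator {a..b} t)"
      using int has_integral_unique by blast
    then have "ennreal \<bar>g b - g a\<bar> \<le> (\<integral>\<^sup>+t. ennreal (norm (\<phi> t * indicator {a..b} t)) \<partial>lborel)"
      using integral_norm_bound_ennreal[OF I] by simp
    with le show ?thesis by (simp add: eq)
  qed (use le in \<open>auto simp: top_unique\<close>)
qed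

section \<open>Directional derivatives of Lipschitz functions\<close>

lemma nn_integral_lborel_affine:
  fixes h :: "'a::euclidean_space \<Rightarrow> ennreal"
  assumes [measurable]: "h \<in> borel_measurable borel" and "c \<noteq> 0"
  shows "(\<integral>\<^sup>+x. h x \<partial>lborel) = ennreal (\<bar>c\<bar> ^ DIM('a)) * (\<integral>\<^sup>+x. h (a + c *\<^sub>R x) \<partial>lborel)"
  by (subst lborel_affine[OF assms(2), of a])
     (simp add: nn_integral_density nn_integral_distr nn_integral_cmult)

lemma lborel_integral_translate:
  fixes h :: "'a::euclidean_space \<Rightarrow> real"
  assumes [measurable]: "h \<in> borel_measurable borel"
  shows "(LINT x|lborel. h (a + x)) = (LINT x|lborel. h x)"
  by (subst (2) lborel_distr_plus[of a, symmetric]) (simp add: integral_distr)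

text \<open>
  A coordinate-free Fubini argument: by translation invariance the complement \<open>N\<close> of \<open>E\<close> has the
  same measure as each \<open>N - t v\<close>. Averaging over \<open>0 \<le> t \<le> 1\<close> and exchanging the integrals
  leaves the one-dimensional measures of the sections of \<open>N\<close> by lines in direction \<open>v\<close>, and these
  vanish. No change of coordinates that aligns \<open>v\<close> with a basis vector is required.
\<close>

lemma AE_lborel_of_AE_lines:
  fixes E :: "'a::euclidean_space set"
  assumes [measurable]: "E \<in> sets borel"
    and lines: "\<And>x. AE t in lborel. x + t *\<^sub>R v \<in> E"
  shows "AE x in lborel. x \<in> E"
proof -
  let ?N = "\<lambda>x t. indicator (- E) (x + t *\<^sub>R v) * indicator {0..1::real} t :: ennreal"
  have "emeasure lborel (- E) = (\<integral>\<^sup>+t. emeasure lborel (- E) * indicator {0..1::real} t \<partial>lborel)"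
    by (simp add: nn_integral_cmult)
  also have "\<dots> = (\<integral>\<^sup>+t. (\<integral>\<^sup>+x. ?N x t \<partial>lborel) \<partial>lborel)"
  proof (rule nn_integral_cong)
    fix t :: real
    have "emeasure lborel (- E) = (\<integral>\<^sup>+x. indicator (- E) x \<partial>lborel)"
      by simp
    also have "\<dots> = (\<integral>\<^sup>+x. indicator (- E) (x + t *\<^sub>R v) \<partial>lborel)"
      using nn_integral_lborel_affine[of "indicator (- E)" 1 "t *\<^sub>R v"] by (simp add: add.commute)
    finally show "emeasure lborel (- E) * indicator {0..1} t = (\<integral>\<^sup>+x. ?N x t \<partial>lborel)"
      by (simp add: nn_integral_multc)
  qed
  also have "\<dots> = (\<integral>\<^sup>+x. (\<integral>\<^sup>+t. ?N x t \<partial>lborel) \<partial>lborel)"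
    by (rule lborel_pair.Fubini') measurable
  also have "\<dots> = (\<integral>\<^sup>+x. 0 \<partial>(lborel :: 'a measure))"
  proof (rule nn_integral_cong)
    fix x :: 'a
    have "AE t in lborel. ?N x t = 0"
      using lines[of x] by eventually_elim auto
    then have "(\<integral>\<^sup>+t. ?N x t \<partial>lborel) = (\<integral>\<^sup>+t. 0 \<partial>(lborel :: real measure))"
      by (rule nn_integral_cong_AE)
    then show "(\<integral>\<^sup>+t. ?N x t \<partial>lborel) = 0" by simp
  qed
  finally show ?thesis
    by (intro AE_I'[of "- E"]) (auto simp: null_sets_def)
qed

text \<open>
  A limit along the fixed sequence \<open>1 / (k + 1)\<close>, so that \<open>dir_deriv f v\<close> is Borel measurable for
  continuous \<open>f\<close> by construction; it is the derivative of \<open>f\<close> in direction \<open>v\<close> wherever that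
  derivative exists.
\<close>

definition dir_deriv :: "('a::real_normed_vector \<Rightarrow> real) \<Rightarrow> 'a \<Rightarrow> 'a \<Rightarrow> real" where
  "dir_deriv f v x = lim (\<lambda>k. (f (x + inverse (real (Suc k)) *\<^sub>R v) - f x) * real (Suc k))"

lemma borel_measurable_dir_deriv:
  fixes f :: "'a::euclidean_space \<Rightarrow> real"
  assumes "continuous_on UNIV f"
  shows "dir_deriv f v \<in> borel_measurable borel"
proof -
  have [measurable]: "f \<in> borel_measurable borel" by (rule borel_measurable_continuous_onI[OF assms])
  show ?thesis unfolding dir_deriv_def[abs_def] by measurable
qed

lemma dir_deriv_LIMSEQ:
  fixes f :: "'a::real_normed_vector \<Rightarrow> real"
  assumes "((\<lambda>h. f (x + h *\<^sub>R v)) has_real_derivative D) (at 0)"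
  shows "(\<lambda>k. (f (x + inverse (real (Suc k)) *\<^sub>R v) - f x) * real (Suc k)) \<longlonglongrightarrow> D"
proof -
  have lim: "((\<lambda>h. (f (x + h *\<^sub>R v) - f x) / h) \<longlongrightarrow> D) (at 0)"
    using assms unfolding has_field_derivative_iff by simp
  have "(\<lambda>k. (f (x + inverse (real (Suc k)) *\<^sub>R v) - f x) / inverse (real (Suc k))) \<longlonglongrightarrow> D"
    by (rule tendsto_compose_eventually[OF lim LIMSEQ_inverse_real_of_nat]) (auto intro: always_eventually)
  then show ?thesis by (simp add: divide_inverse)
qed

lemma dir_deriv_eq:
  fixes f :: "'a::real_normed_vector \<Rightarrow> real"
  assumes "((\<lambda>h. f (x + h *\<^sub>R v)) has_real_derivative D) (at 0)"
  shows "dir_deriv f v x = D"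
  unfolding dir_deriv_def by (rule limI[OF dir_deriv_LIMSEQ[OF assms]])

text \<open>
  The derivative exists iff the difference quotients satisfy the Cauchy criterion. For fixed
  \<open>k\<close> and \<open>m\<close> the criterion is an intersection of closed conditions on \<open>x\<close>, even though it ranges
  over uncountably many pairs of increments; only \<open>k\<close> and \<open>m\<close> have to be countable.
\<close>

lemma sets_differentiable_along:
  fixes f :: "'a::euclidean_space \<Rightarrow> real"
  assumes f: "continuous_on UNIV f"
  shows "{x. \<exists>D. ((\<lambda>h. f (x + h *\<^sub>R v)) has_real_derivative D) (at 0)} \<in> sets borel"
proof -
  define q where "q h x = (f (x + h *\<^sub>R v) - f x) / h" for h x
  define C where "C k m = {x. \<forall>h h'. 0 < \<bar>h\<bar> \<and> \<bar>h\<bar> < inverse (real (Suc m)) \<and>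
    0 < \<bar>h'\<bar> \<and> \<bar>h'\<bar> < inverse (real (Suc m)) \<longrightarrow> \<bar>q h x - q h' x\<bar> \<le> inverse (real (Suc k))}" for k m
  have contq: "continuous_on UNIV (q h)" if "h \<noteq> 0" for h
    unfolding q_def using that
    by (intro continuous_intros continuous_on_compose2[OF f] f) auto
  have "closed (C k m)" for k m
  proof -
    have "C k m = (\<Inter>(h, h') \<in> {(h, h'). 0 < \<bar>h\<bar> \<and> \<bar>h\<bar> < inverse (real (Suc m)) \<and>
      0 < \<bar>h'\<bar> \<and> \<bar>h'\<bar> < inverse (real (Suc m))}. {x. \<bar>q h x - q h' x\<bar> \<le> inverse (real (Suc k))})"
      by (auto simp: C_def)
    also have "closed \<dots>"
      by (intro closed_INT ballI) (auto intro!: closed_Collect_le continuous_intros contq)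
    finally show ?thesis .
  qed
  then have "(\<Inter>k. \<Union>m. C k m) \<in> sets borel" by (intro sets.countable_INT'') auto
  moreover have "{x. \<exists>D. ((\<lambda>h. f (x + h *\<^sub>R v)) has_real_derivative D) (at 0)} = (\<Inter>k. \<Union>m. C k m)"
  proof (intro set_eqI iffI)
    fix x assume "x \<in> {x. \<exists>D. ((\<lambda>h. f (x + h *\<^sub>R v)) has_real_derivative D) (at 0)}"
    then obtain D where lim: "((\<lambda>h. q h x) \<longlongrightarrow> D) (at 0)"
      by (auto simp: has_field_derivative_iff q_def)
    have "\<exists>m. x \<in> C k m" for k
    proof -
      have "0 < inverse (real (Suc k)) / 2" by simp
      from LIM_D[OF lim this] obtain s where s: "s > 0"
        "\<And>h. h \<noteq> 0 \<Longrightarrow> \<bar>h\<bar> < s \<Longrightarrow> \<bar>q h x - D\<bar> < inverse (real (Suc k)) / 2" by auto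
      obtain m where m: "inverse (real (Suc m)) < s" using s(1) reals_Archimedean by blast
      have "\<bar>q h x - q h' x\<bar> \<le> inverse (real (Suc k))"
        if "0 < \<bar>h\<bar>" "\<bar>h\<bar> < inverse (real (Suc m))" "0 < \<bar>h'\<bar>" "\<bar>h'\<bar> < inverse (real (Suc m))" for h h'
      proof -
        have "h \<noteq> 0" "\<bar>h\<bar> < s" "h' \<noteq> 0" "\<bar>h'\<bar> < s" using that m by auto
        then show ?thesis using s(2)[of h] s(2)[of h'] by linarith
      qed
      then show ?thesis by (auto simp: C_def)
    qed
    then show "x \<in> (\<Inter>k. \<Union>m. C k m)" by auto
  next
    fix x assume "x \<in> (\<Inter>k. \<Union>m. C k m)"
    then have "\<exists>m. x \<in> C k m" for k by auto
    then obtain m where m: "\<And>k. x \<in> C k (m k)" by metis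
    define u where "u j = q (inverse (real (Suc j))) x" for j
    have small: "\<bar>q h x - u j\<bar> \<le> inverse (real (Suc k))"
      if "0 < \<bar>h\<bar>" "\<bar>h\<bar> < inverse (real (Suc (m k)))" "m k < j" for k h j
      using m[of k] that unfolding C_def u_def by (auto simp: field_simps)
    have "Cauchy u"
    proof (rule metric_CauchyI)
      fix e :: real assume "0 < e"
      then obtain k where k: "inverse (real (Suc k)) < e" using reals_Archimedean by blast
      have "dist (u i) (u j) < e" if "Suc (m k) \<le> i" "Suc (m k) \<le> j" for i j
      proof -
        have "inverse (real (Suc i)) < inverse (real (Suc (m k)))"
          using that by (intro less_imp_inverse_less) auto
        then have "\<bar>u i - u j\<bar> \<le> inverse (real (Suc k))"
          using small[of "inverse (real (Suc i))" k j] that unfolding u_def by simp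
        then show ?thesis using k by (simp add: dist_real_def)
      qed
      then show "\<exists>M. \<forall>i\<ge>M. \<forall>j\<ge>M. dist (u i) (u j) < e" by blast
    qed
    then obtain D where D: "u \<longlonglongrightarrow> D" by (auto simp: Cauchy_convergent_iff convergent_def)
    have close: "\<bar>q h x - D\<bar> \<le> inverse (real (Suc k))"
      if "0 < \<bar>h\<bar>" "\<bar>h\<bar> < inverse (real (Suc (m k)))" for h k
    proof (rule LIMSEQ_le_const2)
      show "(\<lambda>j. \<bar>q h x - u j\<bar>) \<longlonglongrightarrow> \<bar>q h x - D\<bar>" by (intro tendsto_intros D)
      show "\<exists>N. \<forall>j\<ge>N. \<bar>q h x - u j\<bar> \<le> inverse (real (Suc k))"
        using small[OF that] by (intro exI[of _ "Suc (m k)"]) auto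
    qed
    have "((\<lambda>h. q h x) \<longlongrightarrow> D) (at 0)"
    proof (rule LIM_I)
      fix e :: real assume "0 < e"
      then obtain k where k: "inverse (real (Suc k)) < e" using reals_Archimedean by blast
      then show "\<exists>s>0. \<forall>h. h \<noteq> 0 \<and> norm (h - 0) < s \<longrightarrow> norm (q h x - D) < e"
        using close[of _ k] by (intro exI[of _ "inverse (real (Suc (m k)))"]) fastforce
    qed
    then show "x \<in> {x. \<exists>D. ((\<lambda>h. f (x + h *\<^sub>R v)) has_real_derivative D) (at 0)}"
      by (auto simp: has_field_derivative_iff q_def)
  qed
  ultimately show ?thesis by simp
qed

lemma lipschitz_on_line:
  fixes f :: "'a::real_normed_vector \<Rightarrow> real"
  assumes "L-lipschitz_on UNIV f"
  shows "(L * norm v)-lipschitz_on UNIV (\<lambda>t. f (x + t *\<^sub>R v))"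
proof (rule lipschitz_onI)
  fix s t :: real
  have "dist (f (x + s *\<^sub>R v)) (f (x + t *\<^sub>R v)) \<le> L * dist (x + s *\<^sub>R v) (x + t *\<^sub>R v)"
    using lipschitz_onD[OF assms] by blast
  also have "dist (x + s *\<^sub>R v) (x + t *\<^sub>R v) = norm v * dist s t"
    by (simp add: dist_norm flip: scaleR_diff_left)
  finally show "dist (f (x + s *\<^sub>R v)) (f (x + t *\<^sub>R v)) \<le> L * norm v * dist s t"
    by (simp only: mult.assoc)
qed (use lipschitz_on_nonneg[OF assms] in auto)

lemma has_derivative_on_line_iff:
  fixes f :: "'a::real_normed_vector \<Rightarrow> real"
  shows "((\<lambda>h. f ((x + t *\<^sub>R v) + h *\<^sub>R v)) has_real_derivative D) (at 0) \<longleftrightarrow>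
    ((\<lambda>s. f (x + s *\<^sub>R v)) has_real_derivative D) (at t)"
  using DERIV_shift[of "\<lambda>s. f (x + s *\<^sub>R v)" D 0 t] by (simp add: algebra_simps)

lemma AE_has_dir_deriv:
  fixes f :: "'a::euclidean_space \<Rightarrow> real"
  assumes f: "L-lipschitz_on UNIV f"
  shows "AE x in lborel. ((\<lambda>h. f (x + h *\<^sub>R v)) has_real_derivative dir_deriv f v x) (at 0)"
proof -
  let ?E = "{x. \<exists>D. ((\<lambda>h. f (x + h *\<^sub>R v)) has_real_derivative D) (at 0)}"
  have "AE x in lborel. x \<in> ?E"
  proof (rule AE_lborel_of_AE_lines)
    show "?E \<in> sets borel" by (intro sets_differentiable_along lipschitz_on_continuous_on[OF f])
    fix x
    obtain \<phi> where "AE t in lborel. ((\<lambda>t. f (x + t *\<^sub>R v)) has_real_derivative \<phi> t) (at t)"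
      using lipschitz_real_derivative[OF lipschitz_on_line[OF f, of v x]] by metis
    then show "AE t in lborel. x + t *\<^sub>R v \<in> ?E"
      by eventually_elim (auto simp: has_derivative_on_line_iff)
  qed
  then show ?thesis by eventually_elim (auto simp: dir_deriv_eq)
qed

section \<open>Rademacher's theorem\<close>

text \<open>
  Translation is continuous in \<open>L\<^sup>1\<close> at the indicator of a box: off the boundary of the box, which is
  a null set, the indicators converge pointwise.
\<close>

lemma tendsto_integral_translate_cbox:
  fixes a b :: "'a::euclidean_space"
  shows "(\<lambda>k. LINT x|lborel. \<bar>indicator (cbox a b) (x - inverse (real (Suc k)) *\<^sub>R u) - indicator (cbox a b) x :: real\<bar>)
    \<longlonglongrightarrow> 0"
proof -
  define c where "c k = inverse (real (Suc k)) *\<^sub>R u" for k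
  have c0: "c \<longlonglongrightarrow> 0"
    unfolding c_def using tendsto_scaleR[OF LIMSEQ_inverse_real_of_nat tendsto_const, of u] by simp
  have cu: "norm (c k) \<le> norm u" for k
    using mult_left_le_one_le[of "norm u" "inverse (real (Suc k))"] by (simp add: c_def inverse_le_1_iff)
  obtain B where B: "\<And>x. x \<in> cbox a b \<Longrightarrow> norm x \<le> B"
    using bounded_cbox[of a b] by (auto simp: bounded_iff)
  have "(\<lambda>k. LINT x|lborel. \<bar>indicator (cbox a b) (x - c k) - indicator (cbox a b) x :: real\<bar>)
    \<longlonglongrightarrow> (LINT x|(lborel :: 'a measure). 0)"
  proof (rule integral_dominated_convergence[where w = "indicator (cball 0 (B + norm u))"])
    have "AE x in lebesgue. x \<notin> cbox a b - box a b"
      using negligible_frontier_interval[of a b] by (intro AE_not_in) (simp add: negligible_iff_null_sets)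
    then have "AE x in lborel. x \<notin> cbox a b - box a b" by (simp add: AE_completion_iff)
    then show "AE x in lborel. (\<lambda>k. \<bar>indicator (cbox a b) (x - c k) - indicator (cbox a b) x :: real\<bar>) \<longlonglongrightarrow> 0"
    proof eventually_elim
      case (elim x)
      have lim: "(\<lambda>k. x - c k) \<longlonglongrightarrow> x" using tendsto_diff[OF tendsto_const c0, of x] by simp
      have "\<forall>\<^sub>F k in sequentially. (x - c k \<in> cbox a b) = (x \<in> cbox a b)"
      proof (cases "x \<in> cbox a b")
        case True
        with elim have "x \<in> box a b" by blast
        from topological_tendstoD[OF lim open_box this] show ?thesis
          by eventually_elim (use True box_subset_cbox in blast)
      next
        case False
        then have "x \<in> - cbox a b" by simp
        from topological_tendstoD[OF lim _ this] show ?thesis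
          by (auto elim!: eventually_mono simp: False)
      qed
      then have "\<forall>\<^sub>F k in sequentially. \<bar>indicator (cbox a b) (x - c k) - indicator (cbox a b) x :: real\<bar> = 0"
        by eventually_elim (simp add: indicator_def)
      then show ?case by (rule tendsto_eventually)
    qed
    have "emeasure lborel (cball (0::'a) (B + norm u)) < \<infinity>"
      by (rule emeasure_bounded_finite) simp
    then show "integrable lborel (indicator (cball (0::'a) (B + norm u)) :: 'a \<Rightarrow> real)"
      by (intro integrable_real_indicator) auto
    have "\<bar>indicator (cbox a b) (x - c k) - indicator (cbox a b) x :: real\<bar> \<le> indicator (cball 0 (B + norm u)) x" for k x
    proof (cases "norm x \<le> B + norm u")
      case False
      have "norm x \<le> norm (x - c k) + norm u"
        using norm_triangle_ineq[of "x - c k" "c k"] cu[of k] by simp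
      with False have "x - c k \<notin> cbox a b" "x \<notin> cbox a b"
        using B[of x] B[of "x - c k"] norm_ge_zero[of u] by auto
      then show ?thesis by simp
    qed (auto simp: indicator_def)
    then show "AE x in lborel. norm \<bar>indicator (cbox a b) (x - c k) - indicator (cbox a b) x :: real\<bar>
        \<le> indicator (cball 0 (B + norm u)) x" for k
      by simp
  qed measurable
  then show ?thesis by (simp add: c_def)
qed

lemma AE_eq_0_of_integral_cbox_eq_0:
  fixes g :: "'a::euclidean_space \<Rightarrow> real"
  assumes "\<And>a b. (g has_integral 0) (cbox a b)"
  shows "AE x in lborel. g x = 0"
proof -
  have "g integrable_on cbox a b" for a b using assms by blast
  then obtain N where N: "negligible N"
    and lim: "\<And>x e. \<lbrakk>x \<notin> N; 0 < e\<rbrakk> \<Longrightarrow> \<exists>d>0. \<forall>h. 0 < h \<and> h < d \<longrightarrow>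
        norm (integral (cbox x (x + h *\<^sub>R One)) g /\<^sub>R h ^ DIM('a) - g x) < e"
    using integrable_ccontinuous_explicit[of g] by metis
  have "g x = 0" if "x \<notin> N" for x
  proof (rule ccontr)
    assume "g x \<noteq> 0"
    with lim[OF that, of "\<bar>g x\<bar>"] obtain d where "d > 0" and
      d: "\<And>h. 0 < h \<and> h < d \<Longrightarrow> norm (integral (cbox x (x + h *\<^sub>R One)) g /\<^sub>R h ^ DIM('a) - g x) < \<bar>g x\<bar>"
      by auto
    with d[of "d / 2"] show False using integral_unique[OF assms] by simp
  qed
  then have "AE x in lebesgue. g x = 0"
    using N by (intro AE_I'[of N]) (auto simp: negligible_iff_null_sets)
  then show ?thesis by (simp add: AE_completion_iff)
qed

text \<open>
  With \<open>q\<^sub>h\<^sup>w (x) = (f (x + h w) - f x) / h\<close> one has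
  \<open>q\<^sub>h\<^sup>u\<^sup>+\<^sup>v (x) - q\<^sub>h\<^sup>u (x) = q\<^sub>h\<^sup>v (x + h u)\<close>. So the defect of additivity at step \<open>h\<close> is
  the difference of \<open>q\<^sub>h\<^sup>v\<close> and its translate by \<open>h u\<close>. As \<open>q\<^sub>h\<^sup>v\<close> is bounded uniformly in \<open>h\<close>, the
  integral of this difference over a box is at most a constant times the measure of the symmetric
  difference of two nearby boxes, and tends to \<open>0\<close>. Hence the defect of additivity of the limits has
  integral \<open>0\<close> over every box and vanishes almost everywhere.
\<close>

lemma dir_deriv_add:
  fixes f :: "'a::euclidean_space \<Rightarrow> real"
  assumes f: "L-lipschitz_on UNIV f"
  shows "AE x in lborel. dir_deriv f (u + v) x = dir_deriv f u x + dir_deriv f v x"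
proof -
  note cont = lipschitz_on_continuous_on[OF f]
  have [measurable]: "f \<in> borel_measurable borel" by (rule borel_measurable_continuous_onI[OF cont])
  have [measurable]: "dir_deriv f w \<in> borel_measurable borel" for w by (rule borel_measurable_dir_deriv[OF cont])
  have L0: "0 \<le> L" by (rule lipschitz_on_nonneg[OF f])
  define q where "q k w x = (f (x + inverse (real (Suc k)) *\<^sub>R w) - f x) * real (Suc k)" for k w x
  have [measurable]: "q k w \<in> borel_measurable borel" for k w unfolding q_def by measurable
  have qbd: "\<bar>q k w x\<bar> \<le> L * norm w" for k w x
  proof -
    have "\<bar>f (x + inverse (real (Suc k)) *\<^sub>R w) - f x\<bar> \<le> L * (inverse (real (Suc k)) * norm w)"
      using lipschitz_onD[OF f, of "x + inverse (real (Suc k)) *\<^sub>R w" x] by (simp add: dist_real_def dist_norm)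
    then have "\<bar>q k w x\<bar> \<le> L * (inverse (real (Suc k)) * norm w) * real (Suc k)"
      unfolding q_def abs_mult by (intro mult_mono) auto
    also have "\<dots> = L * norm w" by simp
    finally show ?thesis .
  qed
  have qlim: "AE x in lborel. (\<lambda>k. q k w x) \<longlonglongrightarrow> dir_deriv f w x" for w
    using AE_has_dir_deriv[OF f, of w] unfolding q_def by eventually_elim (rule dir_deriv_LIMSEQ)
  define g where "g x = dir_deriv f (u + v) x - dir_deriv f u x - dir_deriv f v x" for x
  have "(g has_integral 0) (cbox a b)" for a b
  proof -
    let ?B = "indicator (cbox a b) :: 'a \<Rightarrow> real"
    have iB: "integrable lborel ?B"
      using emeasure_lborel_cbox_finite[of a b] by (intro integrable_real_indicator) auto
    have dom: "integrable lborel (\<lambda>x. dir_deriv f w x * ?B x)"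
        "\<And>k. integrable lborel (\<lambda>x. q k w x * ?B x)"
        "(\<lambda>k. LINT x|lborel. q k w x * ?B x) \<longlonglongrightarrow> (LINT x|lborel. dir_deriv f w x * ?B x)" for w
    proof -
      have 1: "AE x in lborel. (\<lambda>k. q k w x * ?B x) \<longlonglongrightarrow> dir_deriv f w x * ?B x"
        using qlim[of w] by eventually_elim (intro tendsto_intros)
      have 2: "AE x in lborel. norm (q k w x * ?B x) \<le> L * norm w * ?B x" for k
        using qbd by (auto simp: indicator_def)
      have 3: "integrable lborel (\<lambda>x. L * norm w * ?B x)" using iB by simp
      show "integrable lborel (\<lambda>x. dir_deriv f w x * ?B x)"
        by (rule integrable_dominated_convergence[OF _ _ 3 1 2]) measurable
      show "\<And>k. integrable lborel (\<lambda>x. q k w x * ?B x)"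
        by (rule integrable_dominated_convergence2[OF _ _ 3 1 2]) measurable
      show "(\<lambda>k. LINT x|lborel. q k w x * ?B x) \<longlonglongrightarrow> (LINT x|lborel. dir_deriv f w x * ?B x)"
        by (rule integral_dominated_convergence[OF _ _ 3 1 2]) measurable
    qed
    let ?I = "\<lambda>w k. LINT x|lborel. q k w x * ?B x"
    \<comment> \<open>The additivity defect at step \<open>1 / (k + 1)\<close> is the integral of \<open>q k v\<close> against the
      difference of the indicators of two boxes.\<close>
    have bound: "\<bar>?I (u + v) k - ?I u k - ?I v k\<bar> \<le>
      L * norm v * (LINT x|lborel. \<bar>?B (x - inverse (real (Suc k)) *\<^sub>R u) - ?B x\<bar>)" for k
    proof -
      define c where "c = inverse (real (Suc k)) *\<^sub>R u"
      have qq: "q k (u + v) x - q k u x = q k v (c + x)" for x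
        by (simp add: q_def c_def algebra_simps)
      have "?I (u + v) k - ?I u k = (LINT x|lborel. q k v (c + x) * ?B x)"
        using Bochner_Integration.integral_diff[OF dom(2)[of k "u + v"] dom(2)[of k u]]
        by (simp add: qq flip: left_diff_distrib)
      also have "\<dots> = (LINT x|lborel. q k v x * ?B (x - c))"
        using lborel_integral_translate[of "\<lambda>x. q k v x * ?B (x - c)" c] by simp
      finally have eq: "?I (u + v) k - ?I u k = (LINT x|lborel. q k v x * ?B (x - c))" .
      have iBc: "integrable lborel (\<lambda>x. ?B (x - c))"
      proof -
        have "integrable (distr lborel borel ((+) c)) (\<lambda>x. ?B (x - c))"
          by (subst integrable_distr_eq) (use iB in auto)
        then show ?thesis by (simp only: lborel_distr_plus)
      qed
      have i2: "integrable lborel (\<lambda>x. q k v x * ?B (x - c))"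
        by (rule Bochner_Integration.integrable_bound[of _ "\<lambda>x. L * norm v * ?B (x - c)"])
           (use iBc qbd L0 in \<open>auto simp: abs_mult intro!: mult_right_mono\<close>)
      have "\<bar>?I (u + v) k - ?I u k - ?I v k\<bar> = \<bar>LINT x|lborel. q k v x * (?B (x - c) - ?B x)\<bar>"
        unfolding eq using Bochner_Integration.integral_diff[OF i2 dom(2)[of k v]]
        by (simp add: right_diff_distrib)
      also have "\<dots> \<le> (LINT x|lborel. L * norm v * \<bar>?B (x - c) - ?B x\<bar>)"
      proof (rule integral_abs_bound_integral)
        show "integrable lborel (\<lambda>x. q k v x * (?B (x - c) - ?B x))"
          using Bochner_Integration.integrable_diff[OF i2 dom(2)[of k v]] by (simp add: right_diff_distrib)
        show "integrable lborel (\<lambda>x. L * norm v * \<bar>?B (x - c) - ?B x\<bar>)"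
          using iB iBc by (intro integrable_mult_right integrable_abs Bochner_Integration.integrable_diff)
        show "\<bar>q k v x * (?B (x - c) - ?B x)\<bar> \<le> L * norm v * \<bar>?B (x - c) - ?B x\<bar>" for x
          unfolding abs_mult using qbd by (rule mult_right_mono) simp
      qed
      also have "\<dots> = L * norm v * (LINT x|lborel. \<bar>?B (x - c) - ?B x\<bar>)" by simp
      finally show ?thesis unfolding c_def .
    qed
    have "(\<lambda>k. ?I (u + v) k - ?I u k - ?I v k) \<longlonglongrightarrow> 0"
    proof (rule Lim_null_comparison)
      show "(\<lambda>k. L * norm v * (LINT x|lborel. \<bar>?B (x - inverse (real (Suc k)) *\<^sub>R u) - ?B x\<bar>)) \<longlonglongrightarrow> 0"
        using tendsto_mult[OF tendsto_const tendsto_integral_translate_cbox[of a b u], of "L * norm v"] by simp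
    qed (use bound in auto)
    moreover have "(\<lambda>k. ?I (u + v) k - ?I u k - ?I v k) \<longlonglongrightarrow> (LINT x|lborel. dir_deriv f (u + v) x * ?B x)
        - (LINT x|lborel. dir_deriv f u x * ?B x) - (LINT x|lborel. dir_deriv f v x * ?B x)"
      by (intro tendsto_diff dom(3))
    ultimately have "(LINT x|lborel. g x * ?B x) = 0"
      using LIMSEQ_unique dom(1) by (fastforce simp: g_def left_diff_distrib)
    moreover have "integrable lborel (\<lambda>x. g x * ?B x)"
      using dom(1) by (simp add: g_def left_diff_distrib)
    ultimately have "((\<lambda>x. g x * ?B x) has_integral 0) UNIV"
      using has_integral_integral_lborel by metis
    then show ?thesis by (simp add: has_integral_mult_indicator_iff)
  qed
  from AE_eq_0_of_integral_cbox_eq_0[OF this] show ?thesis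
    by eventually_elim (simp add: g_def)
qed

lemma dir_deriv_scaleR:
  fixes f :: "'a::euclidean_space \<Rightarrow> real"
  assumes "((\<lambda>h. f (x + h *\<^sub>R v)) has_real_derivative D) (at 0)"
  shows "dir_deriv f (c *\<^sub>R v) x = c * D"
proof (rule dir_deriv_eq)
  have "((\<lambda>h. f (x + (h * c) *\<^sub>R v)) has_real_derivative D * c) (at 0)"
    by (rule DERIV_chain2[where f = "\<lambda>h. f (x + h *\<^sub>R v)" and g = "\<lambda>h. h * c"])
       (use assms in \<open>auto intro!: derivative_eq_intros\<close>)
  then show "((\<lambda>h. f (x + h *\<^sub>R c *\<^sub>R v)) has_real_derivative c * D) (at 0)"
    by (simp add: mult.commute)
qed

text \<open>
  A Borel measurable version of the gradient, used in place of \<open>gradient f\<close> wherever integrals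
  are exchanged; \<open>Rademacher\<close> below shows that the two agree almost everywhere.
\<close>

definition partial_gradient :: "('a::euclidean_space \<Rightarrow> real) \<Rightarrow> 'a \<Rightarrow> 'a" where
  "partial_gradient f x = (\<Sum>b\<in>Basis. dir_deriv f b x *\<^sub>R b)"

lemma borel_measurable_partial_gradient:
  fixes f :: "'a::euclidean_space \<Rightarrow> real"
  assumes "continuous_on UNIV f"
  shows "partial_gradient f \<in> borel_measurable borel"
proof -
  have [measurable]: "dir_deriv f w \<in> borel_measurable borel" for w by (rule borel_measurable_dir_deriv[OF assms])
  show ?thesis unfolding partial_gradient_def[abs_def] by measurable
qed

lemma AE_dir_deriv_eq_inner:
  fixes f :: "'a::euclidean_space \<Rightarrow> real"
  assumes f: "L-lipschitz_on UNIV f"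
  shows "AE x in lborel. dir_deriv f v x = v \<bullet> partial_gradient f x"
proof -
  have "AE x in lborel. dir_deriv f (\<Sum>b\<in>B. (v \<bullet> b) *\<^sub>R b) x = (\<Sum>b\<in>B. (v \<bullet> b) * dir_deriv f b x)"
    if "finite B" for B :: "'a set"
    using that
  proof induction
    case empty
    have "dir_deriv f 0 x = 0" for x by (rule dir_deriv_eq) simp
    then show ?case by simp
  next
    case (insert b B)
    from insert.IH dir_deriv_add[OF f, of "(v \<bullet> b) *\<^sub>R b" "\<Sum>b\<in>B. (v \<bullet> b) *\<^sub>R b"] AE_has_dir_deriv[OF f, of b]
    show ?case
    proof eventually_elim
      case (elim x)
      then show ?case using insert.hyps dir_deriv_scaleR[OF elim(3), of "v \<bullet> b"] by simp
    qed
  qed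
  from this[of Basis] show ?thesis
    by (simp add: euclidean_representation partial_gradient_def inner_sum_right mult.commute)
qed

text \<open>
  For a Lipschitz function, control in finitely many directions that form a fine net of the unit sphere
  controls all directions: replacing a unit vector \<open>u\<close> by a net point \<open>s\<close> changes \<open>f (x + t u)\<close>
  by at most \<open>L t \<bar>u - s\<bar>\<close>, and the linear term by at most \<open>t \<bar>u - s\<bar> \<bar>g\<bar>\<close>.
\<close>

lemma gderiv_of_dense_dir_derivs:
  fixes f :: "'a::euclidean_space \<Rightarrow> real"
  assumes f: "L-lipschitz_on UNIV f"
    and dense: "\<And>X. open X \<Longrightarrow> X \<noteq> {} \<Longrightarrow> \<exists>s\<in>S. s \<in> X"
    and der: "\<And>s. s \<in> S \<Longrightarrow> ((\<lambda>h. f (x + h *\<^sub>R s)) has_real_derivative (s \<bullet> g)) (at 0)"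
  shows "GDERIV f x :> g"
  unfolding gderiv_def has_derivative_at_alt
proof (intro conjI allI impI)
  show "bounded_linear (\<lambda>h. h \<bullet> g)" by (rule bounded_linear_inner_left)
  fix e :: real assume e: "0 < e"
  have L0: "0 \<le> L" by (rule lipschitz_on_nonneg[OF f])
  have M: "0 < L + norm g + 1" using L0 norm_ge_zero[of g] by linarith
  define \<delta> where "\<delta> = (e / 2) / (L + norm g + 1)"
  have \<delta>: "0 < \<delta>" using e M by (simp add: \<delta>_def)
  have \<delta>le: "(L + norm g) * \<delta> \<le> e / 2"
  proof -
    have "(L + norm g) * \<delta> \<le> (L + norm g + 1) * \<delta>" using \<delta> by (intro mult_right_mono) auto
    also have "\<dots> = e / 2"
    proof -
      have "c * (z / c) = z" if "0 < c" for c z :: real using that by simp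
      from this[OF M] show ?thesis unfolding \<delta>_def .
    qed
    finally show ?thesis .
  qed
  have cover: "sphere 0 1 \<subseteq> (\<Union>s\<in>S. ball s \<delta>)"
  proof
    fix u :: 'a
    obtain s where "s \<in> S" "s \<in> ball u \<delta>" using dense[of "ball u \<delta>"] \<delta> by auto
    then show "u \<in> (\<Union>s\<in>S. ball s \<delta>)" by (auto simp: dist_commute)
  qed
  then obtain F where F: "F \<subseteq> S" "finite F" "sphere 0 1 \<subseteq> (\<Union>s\<in>F. ball s \<delta>)"
    using compactE_image[OF compact_sphere _ cover] by (metis open_ball)
  have "\<forall>s\<in>F. \<exists>d>0. \<forall>h. \<bar>h\<bar> < d \<longrightarrow> \<bar>f (x + h *\<^sub>R s) - f x - h * (s \<bullet> g)\<bar> \<le> e / 2 * \<bar>h\<bar>"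
  proof
    fix s assume "s \<in> F"
    then have "((\<lambda>h. f (x + h *\<^sub>R s)) has_derivative (*) (s \<bullet> g)) (at 0)"
      using der[of s] F(1) by (auto simp: has_field_derivative_def)
    then have "\<forall>e>0. \<exists>d>0. \<forall>h. norm (h - 0) < d \<longrightarrow>
        norm (f (x + h *\<^sub>R s) - f (x + 0 *\<^sub>R s) - (s \<bullet> g) * (h - 0)) \<le> e * norm (h - 0)"
      unfolding has_derivative_at_alt by blast
    from this[rule_format, of "e / 2"] e
    show "\<exists>d>0. \<forall>h. \<bar>h\<bar> < d \<longrightarrow> \<bar>f (x + h *\<^sub>R s) - f x - h * (s \<bullet> g)\<bar> \<le> e / 2 * \<bar>h\<bar>"
      by (simp add: mult.commute)
  qed
  then obtain d where d: "\<And>s. s \<in> F \<Longrightarrow> 0 < d s"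
    and dd: "\<And>s h. s \<in> F \<Longrightarrow> \<bar>h\<bar> < d s \<Longrightarrow> \<bar>f (x + h *\<^sub>R s) - f x - h * (s \<bullet> g)\<bar> \<le> e / 2 * \<bar>h\<bar>"
    by metis
  \<comment> \<open>The \<open>1\<close> only keeps the set nonempty.\<close>
  define \<eta> where "\<eta> = Min (insert 1 (d ` F))"
  have \<eta>: "0 < \<eta>" "\<And>s. s \<in> F \<Longrightarrow> \<eta> \<le> d s" using F(2) d by (auto simp: \<eta>_def)
  have "norm (f y - f x - (y - x) \<bullet> g) \<le> e * norm (y - x)" if y: "norm (y - x) < \<eta>" for y
  proof (cases "y = x")
    case False
    define t where "t = norm (y - x)"
    define u where "u = (y - x) /\<^sub>R t"
    have t: "0 < t" using False by (simp add: t_def)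
    have yu: "y - x = t *\<^sub>R u" "y = x + t *\<^sub>R u" using t by (simp_all add: u_def)
    have "u \<in> sphere 0 1" using t by (simp add: u_def t_def)
    then obtain s where s: "s \<in> F" "norm (u - s) < \<delta>" using F(3) by (auto simp: dist_norm norm_minus_commute)
    have "\<bar>f (x + t *\<^sub>R u) - f (x + t *\<^sub>R s)\<bar> \<le> L * (t * norm (u - s))"
      using lipschitz_onD[OF f, of "x + t *\<^sub>R u" "x + t *\<^sub>R s"] t
      by (simp add: dist_real_def dist_norm flip: scaleR_diff_right)
    moreover have "\<bar>f (x + t *\<^sub>R s) - f x - t * (s \<bullet> g)\<bar> \<le> e / 2 * t"
      using dd[OF s(1), of t] \<eta>(2)[OF s(1)] y t by (simp add: t_def)
    moreover have "\<bar>t * (s \<bullet> g) - t * (u \<bullet> g)\<bar> \<le> t * (norm (u - s) * norm g)"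
      using Cauchy_Schwarz_ineq2[of "s - u" g] t
      by (simp add: abs_mult inner_diff_left norm_minus_commute flip: right_diff_distrib)
    moreover have "L * (t * norm (u - s)) + t * (norm (u - s) * norm g) \<le> e / 2 * t"
    proof -
      have "L * (t * norm (u - s)) + t * (norm (u - s) * norm g) = t * ((L + norm g) * norm (u - s))"
        by (simp add: algebra_simps)
      also have "\<dots> \<le> t * ((L + norm g) * \<delta>)"
        using s(2) t L0 by (intro mult_left_mono) auto
      also have "\<dots> \<le> t * (e / 2)" using \<delta>le t by (intro mult_left_mono) auto
      also have "\<dots> = e / 2 * t" by (rule mult.commute)
      finally show ?thesis .
    qed
    moreover have "e * t = e / 2 * t + e / 2 * t" by simp
    ultimately have "\<bar>f (x + t *\<^sub>R u) - f x - t * (u \<bullet> g)\<bar> \<le> e * t"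
      by linarith
    moreover have "norm (y - x) = t" by (simp add: t_def)
    moreover have "(y - x) \<bullet> g = t * (u \<bullet> g)" by (simp add: yu(1))
    ultimately show ?thesis by (simp flip: yu(2))
  qed simp
  with \<eta>(1) show "\<exists>d>0. \<forall>y. norm (y - x) < d \<longrightarrow> norm (f y - f x - (y - x) \<bullet> g) \<le> e * norm (y - x)"
    by blast
qed

text \<open>
  The exceptional null set of \<open>AE_dir_deriv_eq_inner\<close> depends on the direction, so the directions are
  restricted to a countable dense set before the null sets are united.
\<close>

theorem Rademacher:
  fixes f :: "'a::euclidean_space \<Rightarrow> real"
  assumes f: "L-lipschitz_on UNIV f"
  shows "AE x in lborel. GDERIV f x :> partial_gradient f x"
proof -
  obtain S :: "'a set" where S: "countable S" "\<And>X. open X \<Longrightarrow> X \<noteq> {} \<Longrightarrow> \<exists>s\<in>S. s \<in> X"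
    using countable_dense_setE by blast
  have "AE x in lborel. ((\<lambda>h. f (x + h *\<^sub>R s)) has_real_derivative (s \<bullet> partial_gradient f x)) (at 0)" for s
    using AE_has_dir_deriv[OF f, of s] AE_dir_deriv_eq_inner[OF f, of s] by eventually_elim simp
  then have "AE x in lborel. \<forall>s\<in>S. ((\<lambda>h. f (x + h *\<^sub>R s)) has_real_derivative (s \<bullet> partial_gradient f x)) (at 0)"
    using S(1) by (intro AE_ball_countable[THEN iffD2]) auto
  then show ?thesis
    by eventually_elim (rule gderiv_of_dense_dir_derivs[OF f S(2)], auto)
qed

section \<open>Domination by a Riesz potential\<close>

text \<open>
  For fixed \<open>t \<noteq> 0\<close> the map \<open>u \<mapsto> x + t u\<close> preserves null sets, so by Tonelli almost every
  line through \<open>x\<close> meets \<open>N\<close> in a null set of parameters. The parameter \<open>t = 0\<close>, where all lines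
  pass through \<open>x\<close>, is left out because \<open>x\<close> may lie in \<open>N\<close>.
\<close>

lemma AE_on_rays:
  fixes N :: "'a::euclidean_space set"
  assumes N: "N \<in> null_sets lborel"
  shows "AE u in lborel. AE t::real in lborel. t \<noteq> 0 \<longrightarrow> x + t *\<^sub>R u \<notin> N"
proof -
  have [measurable]: "N \<in> sets borel" using N by auto
  let ?K = "\<lambda>u t. indicator N (x + t *\<^sub>R u) * indicator (- {0}) t :: ennreal"
  have "(\<integral>\<^sup>+u. \<integral>\<^sup>+t. ?K u t \<partial>lborel \<partial>lborel) = (\<integral>\<^sup>+t. \<integral>\<^sup>+u. ?K u t \<partial>lborel \<partial>lborel)"
    by (rule lborel_pair.Fubini'[symmetric]) measurable
  also have "\<dots> = (\<integral>\<^sup>+t. 0 \<partial>(lborel :: real measure))"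
  proof (rule nn_integral_cong)
    fix t :: real
    show "(\<integral>\<^sup>+u. ?K u t \<partial>lborel) = 0"
    proof (cases "t = 0")
      case False
      have "ennreal (\<bar>t\<bar> ^ DIM('a)) * (\<integral>\<^sup>+u. indicator N (x + t *\<^sub>R u) \<partial>lborel) = emeasure lborel N"
        using nn_integral_lborel_affine[of "indicator N" t x] False by simp
      also have "\<dots> = 0" using N by auto
      finally show ?thesis using False by simp
    qed simp
  qed
  finally have "(\<integral>\<^sup>+u. \<integral>\<^sup>+t. ?K u t \<partial>lborel \<partial>lborel) = 0" by simp
  then have "AE u in lborel. (\<integral>\<^sup>+t. ?K u t \<partial>lborel) = 0"
    by (subst (asm) nn_integral_0_iff_AE) auto
  then show ?thesis
  proof eventually_elim
    case (elim u)
    then have "AE t in lborel. ?K u t = 0" by (subst (asm) nn_integral_0_iff_AE) auto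
    then show ?case by eventually_elim (auto simp: indicator_def split: if_splits)
  qed
qed

lemma gderiv_along_line:
  assumes "GDERIV f (x + t *\<^sub>R u) :> g"
  shows "((\<lambda>t. f (x + t *\<^sub>R u)) has_real_derivative (u \<bullet> g)) (at t)"
proof -
  have line: "((\<lambda>t. x + t *\<^sub>R u) has_derivative (\<lambda>h. h *\<^sub>R u)) (at t)"
    by (auto intro!: derivative_eq_intros)
  have "((\<lambda>t. f (x + t *\<^sub>R u)) has_derivative (\<lambda>h. (h *\<^sub>R u) \<bullet> g)) (at t)"
    using has_derivative_compose[OF line] assms unfolding gderiv_def by blast
  then show ?thesis by (simp add: has_field_derivative_def mult.commute[of _ "u \<bullet> g"])
qed

lemma le_integral_along_ray:
  fixes f :: "'a::euclidean_space \<Rightarrow> real"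
  assumes f: "L-lipschitz_on UNIV f"
    and supp: "\<And>y. R \<le> norm y \<Longrightarrow> f y = 0" and u: "1 \<le> norm u"
    and der: "AE t in lborel. t \<noteq> 0 \<longrightarrow> (GDERIV f (x + t *\<^sub>R u) :> g (x + t *\<^sub>R u))"
  shows "ennreal \<bar>f x\<bar> \<le> (\<integral>\<^sup>+t. ennreal (norm (g (x + t *\<^sub>R u)) * norm u) * indicator {0<..} t \<partial>lborel)"
proof -
  \<comment> \<open>As \<open>\<bar>u\<bar> \<ge> 1\<close>, the ray has left the support of \<open>f\<close> by time \<open>T\<close>.\<close>
  define T where "T = \<bar>R\<bar> + norm x"
  have T: "0 \<le> T" by (simp add: T_def)
  have "R \<le> norm (x + T *\<^sub>R u)"
  proof -
    have "T \<le> T * norm u" using T u by (simp add: mult_le_cancel_left1)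
    also have "\<dots> \<le> norm (x + T *\<^sub>R u) + norm x"
      using norm_triangle_ineq4[of "x + T *\<^sub>R u" x] T by simp
    finally show ?thesis by (simp add: T_def)
  qed
  then have "f (x + T *\<^sub>R u) = 0" by (rule supp)
  then have "ennreal \<bar>f x\<bar> = ennreal \<bar>f (x + T *\<^sub>R u) - f (x + 0 *\<^sub>R u)\<bar>" by simp
  also have "\<dots> \<le> (\<integral>\<^sup>+t. ennreal (norm (g (x + t *\<^sub>R u)) * norm u) * indicator {0..T} t \<partial>lborel)"
  proof (rule lipschitz_increment_le_nn_integral[OF lipschitz_on_line[OF f] T])
    have "AE t in lborel. t \<noteq> (0::real)"
      by (rule AE_lborel_singleton)
    with der show "AE t in lborel. \<forall>D. ((\<lambda>t. f (x + t *\<^sub>R u)) has_real_derivative D) (at t) \<longrightarrow>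
      ennreal \<bar>D\<bar> \<le> ennreal (norm (g (x + t *\<^sub>R u)) * norm u)"
    proof eventually_elim
      case (elim t)
      then have der_t: "((\<lambda>t. f (x + t *\<^sub>R u)) has_real_derivative (u \<bullet> g (x + t *\<^sub>R u))) (at t)"
        by (auto intro: gderiv_along_line)
      show ?case
        using DERIV_unique[OF der_t] Cauchy_Schwarz_ineq2[of u "g (x + t *\<^sub>R u)"]
        by (auto intro!: ennreal_leI simp: mult.commute)
    qed
  qed
  also have "\<dots> \<le> (\<integral>\<^sup>+t. ennreal (norm (g (x + t *\<^sub>R u)) * norm u) * indicator {0<..} t \<partial>lborel)"
  proof (rule nn_integral_mono_AE)
    have "AE t in lborel. t \<noteq> (0::real)"
      by (rule AE_lborel_singleton)
    then show "AE t in lborel. ennreal (norm (g (x + t *\<^sub>R u)) * norm u) * indicator {0..T} t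
      \<le> ennreal (norm (g (x + t *\<^sub>R u)) * norm u) * indicator {0<..} t"
      by eventually_elim (auto simp: indicator_def)
  qed
  finally show ?thesis .
qed

text \<open>
  The directions over which rays are averaged. An annulus instead of the unit sphere replaces polar
  coordinates by the scaling \<open>y = x + t u\<close> of Lebesgue measure.
\<close>

definition annulus :: "'a::euclidean_space set" where
  "annulus = cball 0 2 - ball 0 1"

lemma emeasure_annulus:
  obtains \<alpha> where "0 < \<alpha>" "emeasure lborel (annulus :: 'a::euclidean_space set) = ennreal \<alpha>"
proof -
  let ?A = "annulus :: 'a set"
  obtain b :: 'a where b: "b \<in> Basis" using nonempty_Basis by blast
  have "ball ((3/2) *\<^sub>R b) (1/2) \<subseteq> ?A"
  proof
    fix y assume "y \<in> ball ((3/2) *\<^sub>R b) (1/2)"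
    then have "norm (y - (3/2) *\<^sub>R b) < 1/2" by (simp add: dist_norm norm_minus_commute)
    moreover have "norm ((3/2) *\<^sub>R b) = 3/2" using b by simp
    ultimately show "y \<in> ?A"
      using norm_triangle_ineq2[of y "(3/2) *\<^sub>R b"] norm_triangle_ineq2[of "(3/2) *\<^sub>R b" y]
      by (simp add: annulus_def norm_minus_commute)
  qed
  then have "emeasure lborel (ball ((3/2) *\<^sub>R b) (1/2)) \<le> emeasure lborel ?A"
    by (intro emeasure_mono) (auto simp: annulus_def)
  moreover have "0 < emeasure lborel (ball ((3/2) *\<^sub>R b) (1/2))"
    by (simp add: emeasure_ball unit_ball_vol_pos)
  ultimately have pos: "0 < emeasure lborel ?A" by simp
  have "emeasure lborel ?A < \<infinity>"
    by (rule emeasure_bounded_finite) (auto simp: annulus_def intro: bounded_subset[OF bounded_cball])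
  with pos show thesis
    by (intro that[of "enn2real (emeasure lborel ?A)"]) (auto simp: enn2real_positive_iff top.not_eq_extremum)
qed

text \<open>
  With \<open>r = \<bar>x - y\<bar>\<close>, the point \<open>(y - x) / t\<close> lies in the annulus exactly for \<open>r / 2 \<le> t \<le> r\<close>.
  On this interval of length \<open>r / 2\<close> the integrand is at most its value at \<open>t = r / 2\<close>.
\<close>

lemma annulus_kernel_integral_le:
  fixes x y :: "'a::euclidean_space"
  assumes c0: "0 \<le> c"
  shows "(\<integral>\<^sup>+t. ennreal (inverse (t ^ n)) * (ennreal (c * (norm (y - x) / t)) *
      indicator annulus ((1 / t) *\<^sub>R (y - x))) * indicator {0<..} t \<partial>lborel)
    \<le> ennreal (2 ^ n) * ennreal (norm (x - y) / norm (x - y) ^ n * c)"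
proof (cases "y = x")
  case False
  define r where "r = norm (y - x)"
  have r: "0 < r" using False by (simp add: r_def)
  define B where "B = inverse ((r / 2) ^ n) * (c * 2)"
  have B0: "0 \<le> B" using r c0 by (simp add: B_def)
  have "(\<integral>\<^sup>+t. ennreal (inverse (t ^ n)) * (ennreal (c * (norm (y - x) / t)) *
      indicator annulus ((1 / t) *\<^sub>R (y - x))) * indicator {0<..} t \<partial>lborel)
    \<le> (\<integral>\<^sup>+t. ennreal B * indicator {r / 2..r} t \<partial>lborel)"
  proof (rule nn_integral_mono)
    fix t :: real
    show "ennreal (inverse (t ^ n)) * (ennreal (c * (norm (y - x) / t)) *
      indicator annulus ((1 / t) *\<^sub>R (y - x))) * indicator {0<..} t \<le> ennreal B * indicator {r / 2..r} t"
    proof (cases "0 < t \<and> (1 / t) *\<^sub>R (y - x) \<in> annulus")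
      case True
      then have t: "0 < t" "1 \<le> r / t" "r / t \<le> 2" by (auto simp: annulus_def r_def)
      then have tr: "r / 2 \<le> t" "t \<le> r" by (simp_all add: field_simps)
      have "inverse (t ^ n) * (c * (r / t)) \<le> B"
        unfolding B_def using t tr r c0
        by (intro mult_mono mult_left_mono le_imp_inverse_le power_mono) auto
      then show ?thesis
        using t tr True c0 r by (simp add: r_def flip: ennreal_mult) (auto intro!: ennreal_leI)
    qed auto
  qed
  also have "\<dots> = ennreal (B * (r / 2))"
    using r B0 by (simp add: nn_integral_cmult flip: ennreal_mult)
  also have "B * (r / 2) = 2 ^ n * (norm (x - y) / norm (x - y) ^ n * c)"
    using r by (simp add: B_def r_def norm_minus_commute power_divide field_simps)
  also have "ennreal (2 ^ n * (norm (x - y) / norm (x - y) ^ n * c)) =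
      ennreal (2 ^ n) * ennreal (norm (x - y) / norm (x - y) ^ n * c)"
    by (rule ennreal_mult) (use c0 in auto)
  finally show ?thesis .
qed simp

text \<open>
  The bound \<open>\<bar>f x\<bar> \<le> \<integral>\<^sub>0\<^sup>\<infinity> \<bar>\<nabla>f (x + t u)\<bar> \<bar>u\<bar> dt\<close> holds for almost every \<open>u\<close> in the annulus. It is
  integrated over \<open>u\<close>; after exchanging the integrals and substituting \<open>y = x + t u\<close> for fixed \<open>t\<close>,
  the integral over \<open>t\<close> is evaluated first and leaves the kernel \<open>\<bar>x - y\<bar>\<^sup>1\<^sup>-\<^sup>n\<close>. The kernel is
  written \<open>\<bar>x - y\<bar> / \<bar>x - y\<bar>\<^sup>n\<close> to avoid negative exponents.
\<close>

lemma lipschitz_le_riesz_potential: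
  fixes f :: "'a::euclidean_space \<Rightarrow> real"
  assumes f: "L-lipschitz_on UNIV f"
    and supp: "\<And>y. R \<le> norm y \<Longrightarrow> f y = 0"
  shows "ennreal \<bar>f x\<bar> * emeasure lborel (annulus :: 'a set) \<le> ennreal (2 ^ DIM('a)) *
    (\<integral>\<^sup>+y. ennreal (norm (x - y) / norm (x - y) ^ DIM('a) * norm (partial_gradient f y)) \<partial>lborel)"
proof -
  define n where "n = DIM('a)"
  define G where "G y = norm (partial_gradient f y)" for y
  have [measurable]: "partial_gradient f \<in> borel_measurable borel"
    by (rule borel_measurable_partial_gradient[OF lipschitz_on_continuous_on[OF f]])
  have [measurable]: "G \<in> borel_measurable borel" unfolding G_def by measurable
  have [measurable]: "(annulus :: 'a set) \<in> sets borel" by (simp add: annulus_def)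
  obtain N where N: "N \<in> null_sets lborel" and bad: "{y. \<not> (GDERIV f y :> partial_gradient f y)} \<subseteq> N"
    using Rademacher[OF f] by (auto simp: eventually_ae_filter)
  let ?A = "annulus :: 'a set"
  let ?H = "\<lambda>t y. ennreal (G y * (norm (y - x) / t)) * indicator ?A ((1 / t) *\<^sub>R (y - x))"
  have "ennreal \<bar>f x\<bar> * emeasure lborel ?A = (\<integral>\<^sup>+u. ennreal \<bar>f x\<bar> * indicator ?A u \<partial>lborel)"
    by (simp add: nn_integral_cmult)
  also have "\<dots> \<le> (\<integral>\<^sup>+u. (\<integral>\<^sup>+t. ennreal (G (x + t *\<^sub>R u) * norm u) * indicator {0<..} t * indicator ?A u \<partial>lborel) \<partial>lborel)"
  proof (rule nn_integral_mono_AE)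
    show "AE u in lborel. ennreal \<bar>f x\<bar> * indicator ?A u \<le>
      (\<integral>\<^sup>+t. ennreal (G (x + t *\<^sub>R u) * norm u) * indicator {0<..} t * indicator ?A u \<partial>lborel)"
      using AE_on_rays[OF N, of x]
    proof eventually_elim
      case (elim u)
      show ?case
      proof (cases "u \<in> ?A")
        case True
        then have "1 \<le> norm u" by (simp add: annulus_def)
        moreover have "AE t in lborel. t \<noteq> 0 \<longrightarrow> (GDERIV f (x + t *\<^sub>R u) :> partial_gradient f (x + t *\<^sub>R u))"
          using elim by eventually_elim (use bad in blast)
        ultimately show ?thesis
          using le_integral_along_ray[OF f supp] True by (simp add: G_def)
      qed simp
    qed
  qed
  also have "\<dots> = (\<integral>\<^sup>+t. (\<integral>\<^sup>+u. ennreal (G (x + t *\<^sub>R u) * norm u) * indicator {0<..} t * indicator ?A u \<partial>lborel) \<partial>lborel)"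
    by (rule lborel_pair.Fubini'[symmetric]) measurable
  also have "\<dots> = (\<integral>\<^sup>+t. (\<integral>\<^sup>+y. ennreal (inverse (t ^ n)) * ?H t y * indicator {0<..} t \<partial>lborel) \<partial>lborel)"
  proof (rule nn_integral_cong)
    fix t :: real
    show "(\<integral>\<^sup>+u. ennreal (G (x + t *\<^sub>R u) * norm u) * indicator {0<..} t * indicator ?A u \<partial>lborel) =
      (\<integral>\<^sup>+y. ennreal (inverse (t ^ n)) * ?H t y * indicator {0<..} t \<partial>lborel)"
    proof (cases "0 < t")
      case True
      have "(\<integral>\<^sup>+y. ?H t y \<partial>lborel) = ennreal (t ^ n) *
          (\<integral>\<^sup>+u. ennreal (G (x + t *\<^sub>R u) * norm u) * indicator ?A u \<partial>lborel)"
        using nn_integral_lborel_affine[of "?H t" t x] True by (simp add: n_def)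
      then have "ennreal (inverse (t ^ n)) * (\<integral>\<^sup>+y. ?H t y \<partial>lborel) =
          (\<integral>\<^sup>+u. ennreal (G (x + t *\<^sub>R u) * norm u) * indicator ?A u \<partial>lborel)"
        using True by (simp flip: mult.assoc ennreal_mult)
      then show ?thesis using True by (simp add: nn_integral_cmult)
    qed simp
  qed
  also have "\<dots> = (\<integral>\<^sup>+y. (\<integral>\<^sup>+t. ennreal (inverse (t ^ n)) * ?H t y * indicator {0<..} t \<partial>lborel) \<partial>lborel)"
    by (rule lborel_pair.Fubini') measurable
  also have "\<dots> \<le> (\<integral>\<^sup>+y. ennreal (2 ^ n) * ennreal (norm (x - y) / norm (x - y) ^ n * G y) \<partial>lborel)"
    by (intro nn_integral_mono annulus_kernel_integral_le) (simp add: G_def)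
  also have "\<dots> = ennreal (2 ^ n) * (\<integral>\<^sup>+y. ennreal (norm (x - y) / norm (x - y) ^ n * G y) \<partial>lborel)"
    by (rule nn_integral_cmult) measurable
  finally show ?thesis by (simp add: n_def G_def)
qed

section \<open>Weights in the Muckenhoupt class\<close>

lemma weight_integrable_ball:
  fixes w :: "'a::euclidean_space \<Rightarrow> real"
  assumes "is_weight w"
  shows "set_integrable lebesgue (ball a r) w"
proof -
  have "w absolutely_integrable_on cball a r" using assms by (simp add: is_weight_def)
  then show ?thesis by (rule set_integrable_subset) auto
qed

lemma weight_of_ball_mono:
  fixes w :: "'a::euclidean_space \<Rightarrow> real"
  assumes w: "is_weight w" and "r \<le> s"
  shows "weight_of w (ball a r) \<le> weight_of w (ball a s)"
proof -
  have "ball a r \<subseteq> ball a s" using assms(2) by auto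
  moreover have "0 \<le> w y" for y using w by (simp add: is_weight_def)
  ultimately show ?thesis
    using weight_integrable_ball[OF w] unfolding weight_of_def set_lebesgue_integral_def set_integrable_def
    by (intro integral_mono) (auto simp: indicator_def)
qed

lemma weight_of_ball_eq_0:
  fixes w :: "'a::euclidean_space \<Rightarrow> real"
  assumes w: "is_weight w" and "weight_of w (ball a r) = 0"
  shows "AE y in lebesgue. y \<in> ball a r \<longrightarrow> w y = 0"
proof -
  have "0 \<le> w y" for y using w by (simp add: is_weight_def)
  then have "AE y in lebesgue. indicator (ball a r) y *\<^sub>R w y = 0"
    using assms(2) weight_integrable_ball[OF w, of a r]
    unfolding weight_of_def set_lebesgue_integral_def set_integrable_def
    by (subst (asm) integral_nonneg_eq_0_iff_AE) auto
  then show ?thesis by eventually_elim (auto simp: indicator_def)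
qed

lemma ex_ball_positive_weight:
  fixes w :: "'a::euclidean_space \<Rightarrow> real"
  assumes w: "is_weight w"
  obtains R where "r \<le> R" "0 < R" "0 < weight_of w (ball a R)"
proof -
  have "\<exists>k::nat. 0 < weight_of w (ball a (real k))"
  proof (rule ccontr)
    assume "\<not> ?thesis"
    then have "weight_of w (ball a (real k)) = 0" for k :: nat
      using weight_of_nonneg[OF w, of "ball a (real k)"] by (simp add: not_less order_antisym)
    then have "AE y in lebesgue. y \<in> ball a (real k) \<longrightarrow> w y = 0" for k :: nat
      by (rule weight_of_ball_eq_0[OF w])
    then have "AE y in lebesgue. \<forall>k::nat. y \<in> ball a (real k) \<longrightarrow> w y = 0"
      by (subst AE_all_countable) blast
    then have "AE y in lebesgue. w y = 0"
    proof eventually_elim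
      case (elim y)
      obtain k :: nat where "dist a y < real k" using reals_Archimedean2 by blast
      with elim show ?case by auto
    qed
    then show False using w by (simp add: is_weight_def)
  qed
  then obtain k :: nat where "0 < weight_of w (ball a (real k))" by blast
  then have "0 < weight_of w (ball a (real k))" .
  also have "\<dots> \<le> weight_of w (ball a (max r (real k + 1)))"
    by (rule weight_of_ball_mono[OF w]) simp
  finally show thesis by (intro that[of "max r (real k + 1)"]) simp_all
qed

lemma AE_ball_obtain_point:
  fixes P :: "'a::euclidean_space \<Rightarrow> bool"
  assumes "0 < r" "AE y in lebesgue. y \<in> ball a r \<longrightarrow> P y"
  obtains y where "y \<in> ball a r" "P y"
proof (rule ccontr)
  assume "\<not> thesis"
  then have "\<not> P y" if "y \<in> ball a r" for y using \<open>\<And>y. y \<in> ball a r \<Longrightarrow> P y \<Longrightarrow> thesis\<close> that by blast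
  with assms(2) have "AE y in lebesgue. y \<notin> ball a r" by (auto elim!: eventually_mono)
  then have "ball a r \<in> null_sets lebesgue" by (subst AE_iff_null_sets) auto
  then have "measure lebesgue (ball a r) = 0" by (simp add: measure_def null_sets_def)
  then show False using assms(1) by simp
qed

text \<open>
  On a large ball with positive average, the condition bounds \<open>C w\<close> below by a positive number almost
  everywhere. So \<open>w\<close> is positive almost everywhere there, and no ball inside can have weight \<open>0\<close>.
  This rules out the default value \<open>0\<close> of the quotient by \<open>w(B)\<close> in the kernel of \<open>T\<^sub>w\<close>.
\<close>

lemma A1_weight_pos:
  fixes w :: "'a::euclidean_space \<Rightarrow> real"
  assumes w: "is_weight w" and A1: "A1_bound w C" and r: "0 < r"
  shows "0 < C" and "0 < weight_of w (ball a r)"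
proof -
  have w0: "0 \<le> w y" for y using w by (simp add: is_weight_def)
  have C0: "0 \<le> C" by (rule A1_bound_nonneg[OF w A1])
  obtain R where R: "r \<le> R" "0 < R" "0 < weight_of w (ball a R)"
    using ex_ball_positive_weight[OF w] .
  have "AE y in lebesgue. y \<in> ball a R \<longrightarrow> weight_of w (ball a R) / measure lebesgue (ball a R) \<le> C * w y"
    using A1 R(2) by (simp add: A1_bound_def)
  moreover have "0 < weight_of w (ball a R) / measure lebesgue (ball a R)"
    using R by simp
  ultimately have *: "AE y in lebesgue. y \<in> ball a R \<longrightarrow> 0 < C * w y"
    by (auto elim!: eventually_mono)
  obtain y where "0 < C * w y" using AE_ball_obtain_point[OF R(2) *] by blast
  then show "0 < C" using C0 w0[of y] by (simp add: zero_less_mult_iff)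
  show "0 < weight_of w (ball a r)"
  proof (rule ccontr)
    assume "\<not> ?thesis"
    then have "weight_of w (ball a r) = 0"
      using weight_of_nonneg[OF w, of "ball a r"] by linarith
    from weight_of_ball_eq_0[OF w this] *
    have "AE y in lebesgue. y \<in> ball a r \<longrightarrow> w y = 0 \<and> 0 < C * w y"
    proof eventually_elim
      case (elim y)
      have "y \<in> ball a r \<longrightarrow> y \<in> ball a R" using R(1) by auto
      with elim show ?case by blast
    qed
    then show False by (rule AE_ball_obtain_point[OF r]) auto
  qed
qed

text \<open>
  Morally this is the condition for the ball \<open>B(x, r)\<close> with \<open>r = \<bar>x - y\<bar>\<close>, but \<open>y\<close> lies on the boundary
  of that ball and the exceptional null set depends on the ball. Both problems disappear when \<open>r\<close> is
  enlarged to a rational radius below \<open>2 r\<close>, which costs the factor \<open>2\<^sup>n\<close>.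
\<close>

lemma A1_kernel_lower_bound:
  fixes w :: "'a::euclidean_space \<Rightarrow> real"
  assumes w: "is_weight w" and A1: "A1_bound w C"
  shows "AE y in lebesgue. norm (x - y) / norm (x - y) ^ DIM('a) \<le>
    C * 2 ^ DIM('a) * unit_ball_vol (real DIM('a)) * (norm (x - y) / weight_of w (ball x (norm (x - y))) * w y)"
proof -
  define n where "n = DIM('a)"
  define V where "V = unit_ball_vol (real n)"
  define W where "W r = weight_of w (ball x r)" for r
  have V: "0 < V" by (simp add: V_def)
  have w0: "0 \<le> w y" for y using w by (simp add: is_weight_def)
  have vol: "measure lebesgue (ball x r) = V * r ^ n" if "0 < r" for r
    using content_ball[of r x] that by (simp add: V_def n_def)
  have "AE y in lebesgue. \<forall>q\<in>{q\<in>\<rat>. 0 < q}. y \<in> ball x q \<longrightarrow> W q / measure lebesgue (ball x q) \<le> C * w y"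
    using A1 countable_rat by (subst AE_ball_countable) (auto simp: A1_bound_def W_def intro: countable_subset)
  then have "AE y in lebesgue. norm (x - y) / norm (x - y) ^ n \<le> C * 2 ^ n * V * (norm (x - y) / W (norm (x - y)) * w y)"
  proof eventually_elim
    case (elim y)
    define r where "r = norm (x - y)"
    show ?case
    proof (cases "r = 0")
      case False
      then have r: "0 < r" by (simp add: r_def)
      obtain q where q: "q \<in> \<rat>" "r < q" "q < 2 * r" using Rats_dense_in_real[of r "2 * r"] r by auto
      have Wr: "0 < W r" unfolding W_def by (rule A1_weight_pos(2)[OF w A1 r])
      have "W r \<le> W q" unfolding W_def using q by (intro weight_of_ball_mono[OF w]) auto
      also have "W q \<le> C * w y * (V * q ^ n)"
      proof -
        have "W q / measure lebesgue (ball x q) \<le> C * w y"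
          using elim q r by (auto simp: r_def dist_norm)
        moreover have "0 < V * q ^ n" using V q r by simp
        ultimately show ?thesis using vol[of q] q r by (simp add: pos_divide_le_eq)
      qed
      also have "\<dots> \<le> C * w y * (V * (2 * r) ^ n)"
        using q r V w0[of y] A1_weight_pos(1)[OF w A1 r] by (intro mult_left_mono power_mono) auto
      finally have "W r \<le> (C * 2 ^ n * V * w y) * r ^ n" by (simp add: power_mult_distrib algebra_simps)
      then have "1 / r ^ n \<le> (C * 2 ^ n * V * w y) / W r"
        using r Wr by (simp add: field_simps)
      then have "r * (1 / r ^ n) \<le> r * ((C * 2 ^ n * V * w y) / W r)"
        using r by (intro mult_left_mono) auto
      then show ?thesis by (simp add: r_def algebra_simps)
    qed (simp add: r_def)
  qed
  then show ?thesis by (simp add: n_def V_def W_def)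
qed

text \<open>
  The constant is first moved to the side of the Riesz potential, whose integrand is visibly
  measurable; the integrand of \<open>T\<^sub>w\<close> is then only compared pointwise.
\<close>

lemma riesz_potential_le_potential_op:
  fixes w :: "'a::euclidean_space \<Rightarrow> real" and g :: "'a \<Rightarrow> real"
  assumes w: "is_weight w" and A1: "A1_bound w C"
    and [measurable]: "g \<in> borel_measurable borel" and g0: "\<And>y. 0 \<le> g y"
  shows "(\<integral>\<^sup>+y. ennreal (norm (x - y) / norm (x - y) ^ DIM('a) * g y) \<partial>lborel)
    \<le> ennreal (C * 2 ^ DIM('a) * unit_ball_vol (real DIM('a))) * potential_op w (\<lambda>y. ennreal (g y)) x"
proof -
  define c where "c = C * 2 ^ DIM('a) * unit_ball_vol (real DIM('a))"
  have c: "0 < c" using A1_weight_pos(1)[OF w A1 zero_less_one] by (simp add: c_def)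
  define I where "I = (\<integral>\<^sup>+y. ennreal (norm (x - y) / norm (x - y) ^ DIM('a) * g y) \<partial>lborel)"
  have w0: "0 \<le> w y" for y using w by (simp add: is_weight_def)
  have "ennreal (1 / c) * I = (\<integral>\<^sup>+y. ennreal (1 / c) * ennreal (norm (x - y) / norm (x - y) ^ DIM('a) * g y) \<partial>lborel)"
    unfolding I_def by (subst nn_integral_cmult) auto
  also have "\<dots> = (\<integral>\<^sup>+y. ennreal (1 / c) * ennreal (norm (x - y) / norm (x - y) ^ DIM('a) * g y) \<partial>lebesgue)"
    by (simp add: nn_integral_completion)
  also have "\<dots> \<le> potential_op w (\<lambda>y. ennreal (g y)) x"
    unfolding potential_op_def
  proof (rule nn_integral_mono_AE)
    show "AE y in lebesgue. ennreal (1 / c) * ennreal (norm (x - y) / norm (x - y) ^ DIM('a) * g y)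
      \<le> ennreal (norm (x - y) / weight_of w (ball x (norm (x - y)))) * ennreal (g y) * ennreal (w y)"
      using A1_kernel_lower_bound[OF w A1, of x]
    proof eventually_elim
      case (elim y)
      define k where "k = norm (x - y) / weight_of w (ball x (norm (x - y)))"
      have k0: "0 \<le> k" using weight_of_nonneg[OF w] by (simp add: k_def)
      have "1 / c * (norm (x - y) / norm (x - y) ^ DIM('a)) \<le> k * w y"
      proof -
        have "norm (x - y) / norm (x - y) ^ DIM('a) \<le> c * (k * w y)"
          using elim unfolding c_def k_def .
        then have "1 / c * (norm (x - y) / norm (x - y) ^ DIM('a)) \<le> 1 / c * (c * (k * w y))"
          using c by (intro mult_left_mono) auto
        then show ?thesis using c by simp
      qed
      then have "1 / c * (norm (x - y) / norm (x - y) ^ DIM('a)) * g y \<le> k * w y * g y"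
        using g0 by (rule mult_right_mono)
      then have "ennreal (1 / c * (norm (x - y) / norm (x - y) ^ DIM('a)) * g y) \<le> ennreal (k * w y * g y)"
        by (rule ennreal_leI)
      moreover have "ennreal (1 / c * (norm (x - y) / norm (x - y) ^ DIM('a)) * g y) =
          ennreal (1 / c) * ennreal (norm (x - y) / norm (x - y) ^ DIM('a) * g y)"
        using c g0[of y] by (simp add: mult.assoc flip: ennreal_mult)
      moreover have "ennreal (k * w y * g y) = ennreal k * ennreal (g y) * ennreal (w y)"
        using k0 w0[of y] g0[of y] by (simp add: ennreal_mult mult_ac)
      ultimately show ?case by (simp only: k_def)
    qed
  qed
  finally have "ennreal c * (ennreal (1 / c) * I) \<le> ennreal c * potential_op w (\<lambda>y. ennreal (g y)) x"
    by (rule mult_left_mono) simp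
  moreover have "ennreal c * (ennreal (1 / c) * I) = I"
    using c by (simp flip: mult.assoc ennreal_mult)
  ultimately show ?thesis by (simp add: I_def c_def)
qed

lemma potential_op_cong_AE:
  fixes u v :: "'a::euclidean_space \<Rightarrow> ennreal"
  assumes "AE y in lborel. u y = v y"
  shows "potential_op w u x = potential_op w v x"
  unfolding potential_op_def
  by (rule nn_integral_cong_AE) (use AE_completion[OF assms] in \<open>auto elim!: eventually_mono\<close>)

section \<open>The representation inequality\<close>

lemma A1_representation_inequality:
  obtains c where "0 \<le> c"
    "\<And>(w :: 'a::euclidean_space \<Rightarrow> real) C f L x. \<lbrakk>is_weight w; A1_bound w C;
      L-lipschitz_on UNIV f; bounded {y. f y \<noteq> 0}\<rbrakk> \<Longrightarrow>
      ennreal \<bar>f x\<bar> \<le> ennreal (c * C) * potential_op w (\<lambda>y. ennreal (norm (gradient f y))) x"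
proof -
  define n where "n = DIM('a)"
  obtain \<alpha> where \<alpha>: "0 < \<alpha>" "emeasure lborel (annulus :: 'a set) = ennreal \<alpha>"
    using emeasure_annulus .
  define c where "c = 2 ^ n / \<alpha> * (2 ^ n * unit_ball_vol (real n))"
  show thesis
  proof
    show "0 \<le> c" using \<alpha> by (simp add: c_def)
    fix w :: "'a \<Rightarrow> real" and C L and f :: "'a \<Rightarrow> real" and x
    assume w: "is_weight w" and A1: "A1_bound w C" and f: "L-lipschitz_on UNIV f"
      and supp: "bounded {y. f y \<noteq> 0}"
    obtain R where "\<And>y. f y \<noteq> 0 \<Longrightarrow> norm y \<le> R" using supp by (auto simp: bounded_iff)
    then have supp': "f y = 0" if "R + 1 \<le> norm y" for y using that by fastforce
    have C: "0 < C" by (rule A1_weight_pos(1)[OF w A1 zero_less_one])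
    have [measurable]: "partial_gradient f \<in> borel_measurable borel"
      by (rule borel_measurable_partial_gradient[OF lipschitz_on_continuous_on[OF f]])
    let ?I = "\<integral>\<^sup>+y. ennreal (norm (x - y) / norm (x - y) ^ DIM('a) * norm (partial_gradient f y)) \<partial>lborel"
    let ?P = "potential_op w (\<lambda>y. ennreal (norm (partial_gradient f y))) x"
    have "ennreal \<bar>f x\<bar> = ennreal (1 / \<alpha>) * (ennreal \<bar>f x\<bar> * ennreal \<alpha>)"
      using \<alpha>(1) by (simp flip: ennreal_mult)
    also have "\<dots> \<le> ennreal (1 / \<alpha>) * (ennreal (2 ^ n) * ?I)"
      using lipschitz_le_riesz_potential[OF f supp', where x = x] by (intro mult_left_mono) (simp_all add: \<alpha> n_def)
    also have "\<dots> \<le> ennreal (1 / \<alpha>) * (ennreal (2 ^ n) * (ennreal (C * 2 ^ n * unit_ball_vol (real n)) * ?P))"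
      unfolding n_def by (intro mult_left_mono riesz_potential_le_potential_op[OF w A1]) auto
    also have "\<dots> = ennreal (c * C) * ?P"
    proof -
      define K where "K = C * 2 ^ n * unit_ball_vol (real n)"
      have "0 \<le> K" using C by (simp add: K_def)
      then have "ennreal (1 / \<alpha> * (2 ^ n * K)) = ennreal (1 / \<alpha>) * (ennreal (2 ^ n) * ennreal K)"
        using \<alpha>(1) by (subst ennreal_mult ennreal_mult; simp)+
      moreover have "1 / \<alpha> * (2 ^ n * K) = c * C" by (simp add: c_def K_def)
      ultimately show ?thesis by (simp only: K_def mult.assoc)
    qed
    also have "?P = potential_op w (\<lambda>y. ennreal (norm (gradient f y))) x"
      by (rule potential_op_cong_AE) (use Rademacher[OF f] in \<open>eventually_elim, simp add: gradient_eq\<close>)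
    finally show "ennreal \<bar>f x\<bar> \<le> ennreal (c * C) * potential_op w (\<lambda>y. ennreal (norm (gradient f y))) x" .
  qed
qed

theorem theorem2p1:
  assumes "CARD('n::finite) \<ge> 2"
  shows "\<exists>c\<ge>0. \<forall>w :: real ^ 'n \<Rightarrow> real. in_A1 w \<longrightarrow>
           (\<forall>f :: real ^ 'n \<Rightarrow> real.
              (\<exists>L. L-lipschitz_on UNIV f) \<longrightarrow> compact (closure {x. f x \<noteq> 0}) \<longrightarrow>
              (\<forall>x. ennreal \<bar>f x\<bar> \<le>
                 ennreal (c * A1_const w) * potential_op w (\<lambda>y. ennreal (norm (gradient f y))) x))"
proof -
  obtain c where c: "0 \<le> c" and
    le: "\<And>(w :: real ^ 'n \<Rightarrow> real) C f L x. \<lbrakk>is_weight w; A1_bound w C;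
      L-lipschitz_on UNIV f; bounded {y. f y \<noteq> 0}\<rbrakk> \<Longrightarrow>
      ennreal \<bar>f x\<bar> \<le> ennreal (c * C) * potential_op w (\<lambda>y. ennreal (norm (gradient f y))) x"
    using A1_representation_inequality[where 'a = "real ^ 'n"] by blast
  show ?thesis
  proof (intro exI[of _ c] conjI c allI impI)
    fix w f :: "real ^ 'n \<Rightarrow> real" and x
    assume w: "in_A1 w" and f: "\<exists>L. L-lipschitz_on UNIV f" and supp: "compact (closure {x. f x \<noteq> 0})"
    obtain L where "L-lipschitz_on UNIV f" using f by blast
    moreover have "is_weight w" using w by (simp add: in_A1_def)
    moreover have "bounded {x. f x \<noteq> 0}"
      using bounded_subset[OF compact_imp_bounded[OF supp] closure_subset] .
    ultimately show "ennreal \<bar>f x\<bar> \<le>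
        ennreal (c * A1_const w) * potential_op w (\<lambda>y. ennreal (norm (gradient f y))) x"
      using le A1_const_least(1)[OF w] by metis
  qed
qed

end
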